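(* Let $(A,\succ,\prec)$ be an anti-dendriform algebra and $(V,l_{\succ},r_{\succ},l_{\prec},r_{\prec})$ a representation of $(A,\succ,\prec)$. Let $(V^*,-r_{\cdot}^*,l_{\prec}^*,r_{\succ}^*,-l_{\cdot}^* )$ be the dual representation, where $r_{\cdot}^*=r_{\prec}^*+r_{\succ}^*$ and $l_{\cdot}^*=l_{\prec}^*+l_{\succ}^*$. Let $\hat A=A\ltimes V^*$, and let $T:V\to A$ be a linear map, identified with an element of $\hat A\otimes\hat A$ through $\mathrm{Hom}(V,A)\simeq A\otimes V^*\subseteq\hat A\otimes\hat A$. Then $r=T-\tau(T)$ is a skew-symmetric solution of the anti-dendriform Yang-Baxter equation in the anti-dendriform algebra $\hat A$ if and only if $T$ is an $\mathcal{O}$-operator of $(A,\succ,\prec)$ associated to $(V,l_{\succ},r_{\succ},l_{\prec},r_{\prec})$.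
   Context: All vector spaces and algebras are over a field $k$, and everything is finite-dimensional. An anti-dendriform algebra $(A,\succ,\prec)$ is a vector space with two bilinear maps $\succ,\prec:A\times A\to A$ such that, writing $x\cdot y=x\succ y+x\prec y$, for all $x,y,z$: $x\succ(y\succ z)=-(x\cdot y)\succ z=-x\prec(y\cdot z)=(x\prec y)\prec z$ and $(x\succ y)\prec z=x\succ(y\prec z)$. A representation of $(A,\succ,\prec)$ is $(V,l_{\succ},r_{\succ},l_{\prec},r_{\prec})$ with $V$ a vector space and linear maps $l_{\succ},r_{\succ},l_{\prec},r_{\prec}:A\to\mathrm{End}(V)$ such that, with $l_{\cdot}=l_{\succ}+l_{\prec}$, $r_{\cdot}=r_{\succ}+r_{\prec}$, for all $x,y\in A$: $l_{\succ}(x)l_{\succ}(y)=-l_{\succ}(x\cdot y)=-l_{\prec}(x)l_{\cdot}(y)=l_{\prec}(x\prec y)$; $r_{\succ}(x\succ y)=-r_{\succ}(y)r_{\cdot}(x)=-r_{\prec}(x\cdot y)=r_{\prec}(y)r_{\prec}(x)$; $l_{\succ}(x)r_{\succ}(y)=-r_{\succ}(y)l_{\cdot}(x)=-l_{\prec}(x)r_{\cdot}(y)=r_{\prec}(y)l_{\prec}(x)$; $l_{\prec}(x\succ y)=l_{\succ}(x)l_{\prec}(y)$; $r_{\prec}(y)r_{\succ}(x)=r_{\succ}(x\prec y)$; $r_{\prec}(y)l_{\succ}(x)=l_{\succ}(x)r_{\prec}(y)$. For $f:A\to\mathrm{End}(V)$, $f^*:A\to\mathrm{End}(V^* )$ is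 defined by $\langle f^*(x)u^*,v\rangle=\langle u^*,f(x)v\rangle$ (no sign). The dual representation $(V^*,-r_{\cdot}^*,l_{\prec}^*,r_{\succ}^*,-l_{\cdot}^* )$ (listed in the order $\succ$-left, $\succ$-right, $\prec$-left, $\prec$-right) is again a representation. The semi-direct product $\hat A=A\ltimes V^*$ is the anti-dendriform algebra on $A\oplus V^*$ with $(x+a^* )\succ(y+b^* )=x\succ y-r_{\cdot}^*(x)b^*+l_{\prec}^*(y)a^*$, $(x+a^* )\prec(y+b^* )=x\prec y+r_{\succ}^*(x)b^*-l_{\cdot}^*(y)a^*$. An $\mathcal{O}$-operator of $(A,\succ,\prec)$ associated to $(V,l_{\succ},r_{\succ},l_{\prec},r_{\prec})$ is a linear map $T:V\to A$ with $T(u)\succ T(v)=T(l_{\succ}(T(u))v+r_{\succ}(T(v))u)$ and $T(u)\prec T(v)=T(l_{\prec}(T(u))v+r_{\prec}(T(v))u)$ for all $u,v\in V$. With a basis $\{v_i\}$ of $V$ and dual basis $\{v_i^*\}$, $T$ corresponds to $\sum_i T(v_i)\otimes v_i^*$; $\tau(x\otimes y)=y\otimes x$. An element $r=\sum_i a_i\otimes b_i$ of $\hat A\otimes\hat A$ is a solution of the anti-dendriform Yang-Baxter equation if $r_{12}\cdot r_{13}+r_{23}\succ r_{12}-r_{13}\prec r_{23}=0$, where $r_{12}\cdot r_{13}=\sum_{i,j}(a_i\cdot a_j)\otimes b_i\otimes b_j$, $r_{23}\succ r_{12}=\sum_{i,j}a_i\otimes(a_j\succ b_i)\otimes b_j$,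 $r_{13}\prec r_{23}=\sum_{i,j}a_i\otimes a_j\otimes(b_i\prec b_j)$. *)

theory Defs
  imports Complex_Main "HOL-Library.Function_Algebras" "HOL-Library.Product_Plus" "HOL-Library.Poly_Mapping"
begin

text \<open>
  A vector space over a field \<open>'k\<close> is given by a scalar action \<open>s :: 'k \<Rightarrow> 'a \<Rightarrow> 'a\<close>
  on an ambient type together with a carrier subspace \<open>S\<close>. Carriers are needed because the dual
  \<open>V*\<close> is a proper subspace of the type \<open>'v \<Rightarrow> 'k\<close>. Sums and negatives of functions are the
  pointwise ones, so \<open>(succ + prec) x y = succ x y + prec x y\<close> is the product written with a dot.
\<close>

definition bilinear_on ::
  "('k::field \<Rightarrow> 'a::ab_group_add \<Rightarrow> 'a) \<Rightarrow> 'a set \<Rightarrow>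
   ('k \<Rightarrow> 'b::ab_group_add \<Rightarrow> 'b) \<Rightarrow> 'b set \<Rightarrow>
   ('k \<Rightarrow> 'c::ab_group_add \<Rightarrow> 'c) \<Rightarrow> 'c set \<Rightarrow> ('a \<Rightarrow> 'b \<Rightarrow> 'c) \<Rightarrow> bool"
  where "bilinear_on sA A sB B sC C f \<longleftrightarrow>
    (\<forall>x\<in>A. \<forall>y\<in>B. f x y \<in> C) \<and>
    (\<forall>x\<in>A. \<forall>x'\<in>A. \<forall>y\<in>B. f (x + x') y = f x y + f x' y) \<and>
    (\<forall>x\<in>A. \<forall>y\<in>B. \<forall>y'\<in>B. f x (y + y') = f x y + f x y') \<and>
    (\<forall>c. \<forall>x\<in>A. \<forall>y\<in>B. f (sA c x) y = sC c (f x y)) \<and>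
    (\<forall>c. \<forall>x\<in>A. \<forall>y\<in>B. f x (sB c y) = sC c (f x y))"

definition anti_dendriform_algebra ::
  "('k::field \<Rightarrow> 'a::ab_group_add \<Rightarrow> 'a) \<Rightarrow> 'a set \<Rightarrow>
   ('a \<Rightarrow> 'a \<Rightarrow> 'a) \<Rightarrow> ('a \<Rightarrow> 'a \<Rightarrow> 'a) \<Rightarrow> bool"
  where "anti_dendriform_algebra sA A succ prec \<longleftrightarrow>
    vector_space sA \<and> module.subspace sA A \<and>
    bilinear_on sA A sA A sA A succ \<and> bilinear_on sA A sA A sA A prec \<and>
    (\<forall>x\<in>A. \<forall>y\<in>A. \<forall>z\<in>A.
      succ x (succ y z) = - succ ((succ + prec) x y) z \<and>
      succ x (succ y z) = - prec x ((succ + prec) y z) \<and>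
      succ x (succ y z) = prec (prec x y) z \<and>
      prec (succ x y) z = succ x (prec y z))"

text \<open>
  A linear map \<open>f : A \<rightarrow> End(V)\<close> is a curried bilinear map \<open>f x v\<close>.
\<close>

definition anti_dendriform_representation ::
  "('k::field \<Rightarrow> 'a::ab_group_add \<Rightarrow> 'a) \<Rightarrow> 'a set \<Rightarrow>
   ('a \<Rightarrow> 'a \<Rightarrow> 'a) \<Rightarrow> ('a \<Rightarrow> 'a \<Rightarrow> 'a) \<Rightarrow>
   ('k \<Rightarrow> 'v::ab_group_add \<Rightarrow> 'v) \<Rightarrow> 'v set \<Rightarrow>
   ('a \<Rightarrow> 'v \<Rightarrow> 'v) \<Rightarrow> ('a \<Rightarrow> 'v \<Rightarrow> 'v) \<Rightarrow>
   ('a \<Rightarrow> 'v \<Rightarrow> 'v) \<Rightarrow> ('a \<Rightarrow> 'v \<Rightarrow> 'v) \<Rightarrow> bool"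
  where "anti_dendriform_representation sA A succ prec sV V lsucc rsucc lprec rprec \<longleftrightarrow>
    vector_space sV \<and> module.subspace sV V \<and>
    bilinear_on sA A sV V sV V lsucc \<and> bilinear_on sA A sV V sV V rsucc \<and>
    bilinear_on sA A sV V sV V lprec \<and> bilinear_on sA A sV V sV V rprec \<and>
    (\<forall>x\<in>A. \<forall>y\<in>A. \<forall>v\<in>V.
      lsucc x (lsucc y v) = - lsucc ((succ + prec) x y) v \<and>
      lsucc x (lsucc y v) = - lprec x ((lsucc + lprec) y v) \<and>
      lsucc x (lsucc y v) = lprec (prec x y) v \<and>
      rsucc (succ x y) v = - rsucc y ((rsucc + rprec) x v) \<and>
      rsucc (succ x y) v = - rprec ((succ + prec) x y) v \<and>
      rsucc (succ x y) v = rprec y (rprec x v) \<and>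
      lsucc x (rsucc y v) = - rsucc y ((lsucc + lprec) x v) \<and>
      lsucc x (rsucc y v) = - lprec x ((rsucc + rprec) y v) \<and>
      lsucc x (rsucc y v) = rprec y (lprec x v) \<and>
      lprec (succ x y) v = lsucc x (lprec y v) \<and>
      rprec y (rsucc x v) = rsucc (prec x y) v \<and>
      rprec y (lsucc x v) = lsucc x (rprec y v))"

definition dual_space :: "('k::field \<Rightarrow> 'v::ab_group_add \<Rightarrow> 'v) \<Rightarrow> ('v \<Rightarrow> 'k) set"
  where "dual_space sV = {u. Vector_Spaces.linear sV (*) u}"

definition dual_scale :: "'k::field \<Rightarrow> ('v \<Rightarrow> 'k) \<Rightarrow> 'v \<Rightarrow> 'k"
  where "dual_scale c u = (\<lambda>v. c * u v)"

definition dual_map :: "('a \<Rightarrow> 'v \<Rightarrow> 'v) \<Rightarrow> 'a \<Rightarrow> ('v \<Rightarrow> 'k) \<Rightarrow> 'v \<Rightarrow> 'k"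
  where "dual_map f x u = (\<lambda>v. u (f x v))"

text \<open>
  The semi-direct product of an algebra with a representation \<open>(W, ls, rs, lp, rp)\<close> lives on
  \<open>A \<times> W\<close>. For \<open>W = V*\<close> it is used with the dual representation.
\<close>

definition semidirect_scale ::
  "('k \<Rightarrow> 'a \<Rightarrow> 'a) \<Rightarrow> ('k \<Rightarrow> 'w \<Rightarrow> 'w) \<Rightarrow> 'k \<Rightarrow> 'a \<times> 'w \<Rightarrow> 'a \<times> 'w"
  where "semidirect_scale sA sW c p = (sA c (fst p), sW c (snd p))"

definition semidirect_prod ::
  "('a \<Rightarrow> 'a \<Rightarrow> 'a) \<Rightarrow> ('a \<Rightarrow> 'w \<Rightarrow> 'w) \<Rightarrow> ('a \<Rightarrow> 'w \<Rightarrow> 'w) \<Rightarrow>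
   'a \<times> 'w::ab_group_add \<Rightarrow> 'a \<times> 'w \<Rightarrow> 'a \<times> 'w"
  where "semidirect_prod m l r p q =
    (m (fst p) (fst q), l (fst p) (snd q) + r (fst q) (snd p))"

text \<open>
  The dual representation is a representation and the semi-direct product is an anti-dendriform
  algebra on its carrier.
\<close>

lemma dual_space_iff:
  assumes "vector_space sV"
  shows "u \<in> dual_space sV \<longleftrightarrow> (\<forall>v w. u (v + w) = u v + u w) \<and> (\<forall>c v. u (sV c v) = c * u v)"
proof -
  have "vector_space ((*) :: 'a \<Rightarrow> 'a \<Rightarrow> 'a)"
    by unfold_locales (auto simp: algebra_simps)
  with assms show ?thesis
    by (auto simp: dual_space_def Vector_Spaces.linear_def module_hom_def
        module_hom_axioms_def module_iff_vector_space)
qed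

lemma vector_space_dual_scale: "vector_space (dual_scale :: 'k::field \<Rightarrow> ('v \<Rightarrow> 'k) \<Rightarrow> 'v \<Rightarrow> 'k)"
  by unfold_locales (auto simp: dual_scale_def algebra_simps fun_eq_iff)

lemma subspace_dual_space:
  assumes "vector_space sV"
  shows "module.subspace dual_scale (dual_space sV)"
proof -
  interpret D: vector_space "dual_scale :: 'a \<Rightarrow> ('b \<Rightarrow> 'a) \<Rightarrow> 'b \<Rightarrow> 'a"
    by (rule vector_space_dual_scale)
  show ?thesis unfolding D.subspace_def
    by (auto simp: dual_space_iff[OF assms] dual_scale_def algebra_simps)
qed


lemma dual_representation:
  assumes V: "anti_dendriform_representation sA UNIV succ prec sV UNIV lsucc rsucc lprec rprec"
  shows "anti_dendriform_representation sA UNIV succ prec dual_scale (dual_space sV)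
    (- (dual_map rprec + dual_map rsucc)) (dual_map lprec)
    (dual_map rsucc) (- (dual_map lprec + dual_map lsucc))"
proof -
  note V = V[unfolded anti_dendriform_representation_def]
  from V have vs: "vector_space sV" by blast
  note ds = dual_space_iff[OF vs]
  have bil: "bilinear_on sA UNIV dual_scale (dual_space sV) dual_scale (dual_space sV) (dual_map f)"
    if "bilinear_on sA UNIV sV UNIV sV UNIV f" for f
    using that by (auto simp: bilinear_on_def ds dual_map_def dual_scale_def fun_eq_iff)
  have bilm: "bilinear_on sA UNIV dual_scale (dual_space sV) dual_scale (dual_space sV)
      (- (dual_map f + dual_map g))"
    if "bilinear_on sA UNIV sV UNIV sV UNIV f" "bilinear_on sA UNIV sV UNIV sV UNIV g" for f g
    using that by (auto simp: bilinear_on_def ds dual_map_def dual_scale_def fun_eq_iff algebra_simps)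
  have add: "lsucc (x + y) v = lsucc x v + lsucc y v" "rsucc (x + y) v = rsucc x v + rsucc y v"
    "lprec (x + y) v = lprec x v + lprec y v" "rprec (x + y) v = rprec x v + rprec y v"
    "lsucc x (v + w) = lsucc x v + lsucc x w" "rsucc x (v + w) = rsucc x v + rsucc x w"
    "lprec x (v + w) = lprec x v + lprec x w" "rprec x (v + w) = rprec x v + rprec x w"
    for x y v w using V by (auto simp: bilinear_on_def)
  {
    fix x y u assume u: "u \<in> dual_space sV"
    have uadd: "u (v + w) = u v + u w" for v w using u ds by blast
    have u0: "u 0 = 0" using uadd[of 0 0] by (metis add_cancel_right_right add_0)
    have umin: "u (- v) = - u v" for v
      using uadd[of v "- v"] u0 by (simp add: eq_neg_iff_add_eq_0 add.commute)
    have E: "u (lsucc x (lsucc y v)) = - u (lsucc ((succ + prec) x y) v)"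
      "u (lsucc x (lsucc y v)) = - u (lprec x ((lsucc + lprec) y v))"
      "u (lsucc x (lsucc y v)) = u (lprec (prec x y) v)"
      "u (rsucc (succ x y) v) = - u (rsucc y ((rsucc + rprec) x v))"
      "u (rsucc (succ x y) v) = - u (rprec ((succ + prec) x y) v)"
      "u (rsucc (succ x y) v) = u (rprec y (rprec x v))"
      "u (lsucc x (rsucc y v)) = - u (rsucc y ((lsucc + lprec) x v))"
      "u (lsucc x (rsucc y v)) = - u (lprec x ((rsucc + rprec) y v))"
      "u (lsucc x (rsucc y v)) = u (rprec y (lprec x v))"
      "u (lprec (succ x y) v) = u (lsucc x (lprec y v))"
      "u (rprec y (rsucc x v)) = u (rsucc (prec x y) v)"
      "u (rprec y (lsucc x v)) = u (lsucc x (rprec y v))" for x y v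
      using V by (metis UNIV_I umin)+
    note F = E[unfolded plus_fun_apply add uadd]
    note D = dual_map_def plus_fun_apply uminus_apply add uadd fun_eq_iff
    have I0: "(- (dual_map rprec + dual_map rsucc)) x ((- (dual_map rprec + dual_map rsucc)) y u) = - (- (dual_map rprec + dual_map rsucc)) ((succ + prec) x y) u"
      unfolding D
      apply (rule allI)
      subgoal for v using F[where x=x and y=y and v=v] F[where x=y and y=x and v=v] by algebra
      done
    have I1: "(- (dual_map rprec + dual_map rsucc)) x ((- (dual_map rprec + dual_map rsucc)) y u) = - (dual_map rsucc) x (((- (dual_map rprec + dual_map rsucc)) + (dual_map rsucc)) y u)"
      unfolding D
      apply (rule allI)
      subgoal for v using F[where x=x and y=y and v=v] F[where x=y and y=x and v=v] by algebra
      done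
    have I2: "(- (dual_map rprec + dual_map rsucc)) x ((- (dual_map rprec + dual_map rsucc)) y u) = (dual_map rsucc) (prec x y) u"
      unfolding D
      apply (rule allI)
      subgoal for v using F[where x=x and y=y and v=v] F[where x=y and y=x and v=v] by algebra
      done
    have I3: "(dual_map lprec) (succ x y) u = - (dual_map lprec) y (((dual_map lprec) + (- (dual_map lprec + dual_map lsucc))) x u)"
      unfolding D
      apply (rule allI)
      subgoal for v using F[where x=x and y=y and v=v] F[where x=y and y=x and v=v] by algebra
      done
    have I4: "(dual_map lprec) (succ x y) u = - (- (dual_map lprec + dual_map lsucc)) ((succ + prec) x y) u"
      unfolding D
      apply (rule allI)
      subgoal for v using F[where x=x and y=y and v=v] F[where x=y and y=x and v=v] by algebra
      done
    have I5: "(dual_map lprec) (succ x y) u = (- (dual_map lprec + dual_map lsucc)) y ((- (dual_map lprec + dual_map lsucc)) x u)"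
      unfolding D
      apply (rule allI)
      subgoal for v using F[where x=x and y=y and v=v] F[where x=y and y=x and v=v] by algebra
      done
    have I6: "(- (dual_map rprec + dual_map rsucc)) x ((dual_map lprec) y u) = - (dual_map lprec) y (((- (dual_map rprec + dual_map rsucc)) + (dual_map rsucc)) x u)"
      unfolding D
      apply (rule allI)
      subgoal for v using F[where x=x and y=y and v=v] F[where x=y and y=x and v=v] by algebra
      done
    have I7: "(- (dual_map rprec + dual_map rsucc)) x ((dual_map lprec) y u) = - (dual_map rsucc) x (((dual_map lprec) + (- (dual_map lprec + dual_map lsucc))) y u)"
      unfolding D
      apply (rule allI)
      subgoal for v using F[where x=x and y=y and v=v] F[where x=y and y=x and v=v] by algebra
      done
    have I8: "(- (dual_map rprec + dual_map rsucc)) x ((dual_map lprec) y u) = (- (dual_map lprec + dual_map lsucc)) y ((dual_map rsucc) x u)"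
      unfolding D
      apply (rule allI)
      subgoal for v using F[where x=x and y=y and v=v] F[where x=y and y=x and v=v] by algebra
      done
    have I9: "(dual_map rsucc) (succ x y) u = (- (dual_map rprec + dual_map rsucc)) x ((dual_map rsucc) y u)"
      unfolding D
      apply (rule allI)
      subgoal for v using F[where x=x and y=y and v=v] F[where x=y and y=x and v=v] by algebra
      done
    have I10: "(- (dual_map lprec + dual_map lsucc)) y ((dual_map lprec) x u) = (dual_map lprec) (prec x y) u"
      unfolding D
      apply (rule allI)
      subgoal for v using F[where x=x and y=y and v=v] F[where x=y and y=x and v=v] by algebra
      done
    have I11: "(- (dual_map lprec + dual_map lsucc)) y ((- (dual_map rprec + dual_map rsucc)) x u) = (- (dual_map rprec + dual_map rsucc)) x ((- (dual_map lprec + dual_map lsucc)) y u)"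
      unfolding D
      apply (rule allI)
      subgoal for v using F[where x=x and y=y and v=v] F[where x=y and y=x and v=v] by algebra
      done
    note I0 I1 I2 I3 I4 I5 I6 I7 I8 I9 I10 I11
  }
  note I = this
  show ?thesis unfolding anti_dendriform_representation_def
  proof (intro conjI ballI)
    show "vector_space (dual_scale :: 'a \<Rightarrow> ('c \<Rightarrow> 'a) \<Rightarrow> 'c \<Rightarrow> 'a)"
      by (rule vector_space_dual_scale)
    show "module.subspace dual_scale (dual_space sV)" by (rule subspace_dual_space[OF vs])
  qed ((assumption | rule I bil bilm | (use V in blast))+)
qed


lemma semidirect_anti_dendriform_algebra:
  assumes A: "anti_dendriform_algebra sA A succ prec"
    and W: "anti_dendriform_representation sA A succ prec sW W lsucc rsucc lprec rprec"
  shows "anti_dendriform_algebra (semidirect_scale sA sW) (A \<times> W)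
    (semidirect_prod succ lsucc rsucc) (semidirect_prod prec lprec rprec)"
proof -
  note A = A[unfolded anti_dendriform_algebra_def]
  note W = W[unfolded anti_dendriform_representation_def]
  interpret A: vector_space sA using A by blast
  interpret W: vector_space sW using W by blast
  interpret P: vector_space "semidirect_scale sA sW"
    by unfold_locales (auto simp: semidirect_scale_def
      A.vector_space_assms W.vector_space_assms)
  have bil: "bilinear_on (semidirect_scale sA sW) (A \<times> W) (semidirect_scale sA sW) (A \<times> W)
      (semidirect_scale sA sW) (A \<times> W) (semidirect_prod m l r)"
    if "bilinear_on sA A sA A sA A m" "bilinear_on sA A sW W sW W l" "bilinear_on sA A sW W sW W r"
    for m l r
    using that W.subspace_add[of W] W
    by (auto simp: bilinear_on_def semidirect_scale_def semidirect_prod_def algebra_simps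
        W.vector_space_assms)
  have sub: "P.subspace (A \<times> W)"
    using A W by (auto simp: P.subspace_def A.subspace_def W.subspace_def semidirect_scale_def zero_prod_def)
  have cl: "succ x y \<in> A" "prec x y \<in> A" "(succ + prec) x y \<in> A" if "x \<in> A" "y \<in> A" for x y
    using A that A.subspace_add[of A] by (auto simp: bilinear_on_def)
  have cw: "lsucc x v \<in> W" "rsucc x v \<in> W" "lprec x v \<in> W" "rprec x v \<in> W"
    if "x \<in> A" "v \<in> W" for x v using W that by (auto simp: bilinear_on_def)
  have cp: "v + w \<in> W" if "v \<in> W" "w \<in> W" for v w using W that W.subspace_add by blast
  have add: 
    "lsucc x (v + w) = lsucc x v + lsucc x w" "rsucc x (v + w) = rsucc x v + rsucc x w"
    "lprec x (v + w) = lprec x v + lprec x w" "rprec x (v + w) = rprec x v + rprec x w"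
    if "x \<in> A" "v \<in> W" "w \<in> W" for x v w using W that by (auto simp: bilinear_on_def)
  {
    fix x y z a b c assume el: "x \<in> A" "y \<in> A" "z \<in> A" "a \<in> W" "b \<in> W" "c \<in> W"
    have "lsucc x (lsucc y c) = - lsucc ((succ + prec) x y) c"
      "lsucc x (lsucc y c) = - lprec x ((lsucc + lprec) y c)"
      "lsucc x (lsucc y c) = lprec (prec x y) c"
      "rsucc (succ y z) a = - rsucc z ((rsucc + rprec) y a)"
      "rsucc (succ y z) a = - rprec ((succ + prec) y z) a"
      "rsucc (succ y z) a = rprec z (rprec y a)"
      "lsucc x (rsucc z b) = - rsucc z ((lsucc + lprec) x b)"
      "lsucc x (rsucc z b) = - lprec x ((rsucc + rprec) z b)"
      "lsucc x (rsucc z b) = rprec z (lprec x b)"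
      "lprec (succ x y) c = lsucc x (lprec y c)"
      "rprec z (rsucc y a) = rsucc (prec y z) a"
      "rprec z (lsucc x b) = lsucc x (rprec z b)" using W el by blast+
    note F = this
    let ?s = "semidirect_prod succ lsucc rsucc" and ?p = "semidirect_prod prec lprec rprec"
    have G: "succ x (succ y z) = - succ ((succ + prec) x y) z"
      "succ x (succ y z) = - prec x ((succ + prec) y z)"
      "succ x (succ y z) = prec (prec x y) z"
      "prec (succ x y) z = succ x (prec y z)" using A el by blast+
    have "?s (x,a) (?s (y,b) (z,c)) = - ?s ((?s + ?p) (x,a) (y,b)) (z,c)"
      by (simp add: semidirect_prod_def el cl cl(3)[unfolded plus_fun_apply] cw cp add G(1)[unfolded plus_fun_apply] F(1,4,7)[unfolded plus_fun_apply] add_ac)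
    moreover have "?s (x,a) (?s (y,b) (z,c)) = - ?p (x,a) ((?s + ?p) (y,b) (z,c))"
      by (simp add: semidirect_prod_def el cl cl(3)[unfolded plus_fun_apply] cw cp add G(2)[unfolded plus_fun_apply] F(2,5,8)[unfolded plus_fun_apply] add_ac)
    moreover have "?s (x,a) (?s (y,b) (z,c)) = ?p (?p (x,a) (y,b)) (z,c)"
      by (simp add: semidirect_prod_def el cl cl(3)[unfolded plus_fun_apply] cw cp add G(3) F(3,6,9) add_ac)
    moreover have "?p (?s (x,a) (y,b)) (z,c) = ?s (x,a) (?p (y,b) (z,c))"
      by (simp add: semidirect_prod_def el cl cl(3)[unfolded plus_fun_apply] cw cp add G(4)[unfolded plus_fun_apply] F(10-12)[unfolded plus_fun_apply] add_ac)
    ultimately have "?s (x,a) (?s (y,b) (z,c)) = - ?s ((?s + ?p) (x,a) (y,b)) (z,c) \<and>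
      ?s (x,a) (?s (y,b) (z,c)) = - ?p (x,a) ((?s + ?p) (y,b) (z,c)) \<and>
      ?s (x,a) (?s (y,b) (z,c)) = ?p (?p (x,a) (y,b)) (z,c) \<and>
      ?p (?s (x,a) (y,b)) (z,c) = ?s (x,a) (?p (y,b) (z,c))" by blast
  }
  note I = this
  show ?thesis unfolding anti_dendriform_algebra_def
    using A W sub P.vector_space_axioms by (auto simp del: plus_fun_apply intro!: bil dest: I)
qed

definition O_operator ::
  "('k::field \<Rightarrow> 'a::ab_group_add \<Rightarrow> 'a) \<Rightarrow>
   ('a \<Rightarrow> 'a \<Rightarrow> 'a) \<Rightarrow> ('a \<Rightarrow> 'a \<Rightarrow> 'a) \<Rightarrow>
   ('k \<Rightarrow> 'v::ab_group_add \<Rightarrow> 'v) \<Rightarrow>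
   ('a \<Rightarrow> 'v \<Rightarrow> 'v) \<Rightarrow> ('a \<Rightarrow> 'v \<Rightarrow> 'v) \<Rightarrow>
   ('a \<Rightarrow> 'v \<Rightarrow> 'v) \<Rightarrow> ('a \<Rightarrow> 'v \<Rightarrow> 'v) \<Rightarrow> ('v \<Rightarrow> 'a) \<Rightarrow> bool"
  where "O_operator sA succ prec sV lsucc rsucc lprec rprec T \<longleftrightarrow>
    Vector_Spaces.linear sV sA T \<and>
    (\<forall>u v. succ (T u) (T v) = T (lsucc (T u) v + rsucc (T v) u)) \<and>
    (\<forall>u v. prec (T u) (T v) = T (lprec (T u) v + rprec (T v) u))"

text \<open>
  Tensor products are free vector spaces modulo the multilinearity relations: an element of
  \<open>S \<otimes> S\<close> is represented by a finitely supported formal combination of pairs from \<open>S\<close>, and it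
  is zero iff it lies in the span \<open>tensor_null2\<close> of the relations; likewise for triples. Two
  representatives are equal as tensors iff their difference is null.
\<close>

definition formal_scale :: "'k::field \<Rightarrow> ('b \<Rightarrow>\<^sub>0 'k) \<Rightarrow> ('b \<Rightarrow>\<^sub>0 'k)"
  where "formal_scale c = Poly_Mapping.map ((*) c)"

definition pure2 :: "'w \<Rightarrow> 'w \<Rightarrow> ('w \<times> 'w \<Rightarrow>\<^sub>0 'k::field)"
  where "pure2 a b = Poly_Mapping.single (a, b) 1"

definition pure3 :: "'w \<Rightarrow> 'w \<Rightarrow> 'w \<Rightarrow> ('w \<times> 'w \<times> 'w \<Rightarrow>\<^sub>0 'k::field)"
  where "pure3 a b c = Poly_Mapping.single (a, b, c) 1"

definition tensor_null2 ::
  "('k::field \<Rightarrow> 'w::ab_group_add \<Rightarrow> 'w) \<Rightarrow> 'w set \<Rightarrow> ('w \<times> 'w \<Rightarrow>\<^sub>0 'k) set"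
  where "tensor_null2 s S = module.span formal_scale (
    {pure2 (a + a') b - pure2 a b - pure2 a' b | a a' b. a \<in> S \<and> a' \<in> S \<and> b \<in> S} \<union>
    {pure2 a (b + b') - pure2 a b - pure2 a b' | a b b'. a \<in> S \<and> b \<in> S \<and> b' \<in> S} \<union>
    {pure2 (s k a) b - formal_scale k (pure2 a b) | k a b. a \<in> S \<and> b \<in> S} \<union>
    {pure2 a (s k b) - formal_scale k (pure2 a b) | k a b. a \<in> S \<and> b \<in> S})"

definition tensor_null3 ::
  "('k::field \<Rightarrow> 'w::ab_group_add \<Rightarrow> 'w) \<Rightarrow> 'w set \<Rightarrow> ('w \<times> 'w \<times> 'w \<Rightarrow>\<^sub>0 'k) set"
  where "tensor_null3 s S = module.span formal_scale (
    {pure3 (a + a') b c - pure3 a b c - pure3 a' b c | a a' b c.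
       a \<in> S \<and> a' \<in> S \<and> b \<in> S \<and> c \<in> S} \<union>
    {pure3 a (b + b') c - pure3 a b c - pure3 a b' c | a b b' c.
       a \<in> S \<and> b \<in> S \<and> b' \<in> S \<and> c \<in> S} \<union>
    {pure3 a b (c + c') - pure3 a b c - pure3 a b c' | a b c c'.
       a \<in> S \<and> b \<in> S \<and> c \<in> S \<and> c' \<in> S} \<union>
    {pure3 (s k a) b c - formal_scale k (pure3 a b c) | k a b c. a \<in> S \<and> b \<in> S \<and> c \<in> S} \<union>
    {pure3 a (s k b) c - formal_scale k (pure3 a b c) | k a b c. a \<in> S \<and> b \<in> S \<and> c \<in> S} \<union>
    {pure3 a b (s k c) - formal_scale k (pure3 a b c) | k a b c. a \<in> S \<and> b \<in> S \<and> c \<in> S})"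

definition tensor_flip :: "('w \<times> 'w \<Rightarrow>\<^sub>0 'k::field) \<Rightarrow> ('w \<times> 'w \<Rightarrow>\<^sub>0 'k)"
  where "tensor_flip r =
    (\<Sum>(a, b)\<in>Poly_Mapping.keys r. Poly_Mapping.single (b, a) (Poly_Mapping.lookup r (a, b)))"

definition skew_symmetric_tensor ::
  "('k::field \<Rightarrow> 'w::ab_group_add \<Rightarrow> 'w) \<Rightarrow> 'w set \<Rightarrow> ('w \<times> 'w \<Rightarrow>\<^sub>0 'k) \<Rightarrow> bool"
  where "skew_symmetric_tensor s S r \<longleftrightarrow>
    Poly_Mapping.keys r \<subseteq> S \<times> S \<and> tensor_flip r - (- r) \<in> tensor_null2 s S"

text \<open>
  For \<open>r = \<Sum>\<^sub>i a\<^sub>i \<otimes> b\<^sub>i\<close> this is \<open>\<Sum>\<^sub>i\<^sub>,\<^sub>j g (a\<^sub>i, b\<^sub>i) (a\<^sub>j, b\<^sub>j)\<close>, the value of \<open>g\<close> being a pure tensor;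
  for the bilinear products below its class depends only on the class of \<open>r\<close>.
\<close>

definition tensor_double_sum ::
  "('w \<times> 'w \<Rightarrow> 'w \<times> 'w \<Rightarrow> 'w \<times> 'w \<times> 'w) \<Rightarrow>
   ('w \<times> 'w \<Rightarrow>\<^sub>0 'k::field) \<Rightarrow> ('w \<times> 'w \<times> 'w \<Rightarrow>\<^sub>0 'k)"
  where "tensor_double_sum g r =
    (\<Sum>p\<in>Poly_Mapping.keys r. \<Sum>q\<in>Poly_Mapping.keys r.
      Poly_Mapping.single (g p q) (Poly_Mapping.lookup r p * Poly_Mapping.lookup r q))"

definition r12_r13 ::
  "('w \<Rightarrow> 'w \<Rightarrow> 'w) \<Rightarrow> ('w \<times> 'w \<Rightarrow>\<^sub>0 'k::field) \<Rightarrow> ('w \<times> 'w \<times> 'w \<Rightarrow>\<^sub>0 'k)"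
  where "r12_r13 m = tensor_double_sum (\<lambda>(ai, bi) (aj, bj). (m ai aj, bi, bj))"

definition r23_r12 ::
  "('w \<Rightarrow> 'w \<Rightarrow> 'w) \<Rightarrow> ('w \<times> 'w \<Rightarrow>\<^sub>0 'k::field) \<Rightarrow> ('w \<times> 'w \<times> 'w \<Rightarrow>\<^sub>0 'k)"
  where "r23_r12 m = tensor_double_sum (\<lambda>(ai, bi) (aj, bj). (ai, m aj bi, bj))"

definition r13_r23 ::
  "('w \<Rightarrow> 'w \<Rightarrow> 'w) \<Rightarrow> ('w \<times> 'w \<Rightarrow>\<^sub>0 'k::field) \<Rightarrow> ('w \<times> 'w \<times> 'w \<Rightarrow>\<^sub>0 'k)"
  where "r13_r23 m = tensor_double_sum (\<lambda>(ai, bi) (aj, bj). (ai, aj, m bi bj))"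

definition anti_dendriform_YBE_solution ::
  "('k::field \<Rightarrow> 'w::ab_group_add \<Rightarrow> 'w) \<Rightarrow> 'w set \<Rightarrow>
   ('w \<Rightarrow> 'w \<Rightarrow> 'w) \<Rightarrow> ('w \<Rightarrow> 'w \<Rightarrow> 'w) \<Rightarrow> ('w \<times> 'w \<Rightarrow>\<^sub>0 'k) \<Rightarrow> bool"
  where "anti_dendriform_YBE_solution s S succ prec r \<longleftrightarrow>
    Poly_Mapping.keys r \<subseteq> S \<times> S \<and>
    r12_r13 (succ + prec) r + r23_r12 succ r - r13_r23 prec r \<in> tensor_null3 s S"

text \<open>
  The element \<open>\<Sum>\<^sub>i T(v\<^sub>i) \<otimes> v\<^sub>i*\<close> for the basis \<open>B\<close> of \<open>V\<close>; the dual basis functional \<open>v*\<close> sends a vector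
  to its coordinate at \<open>v\<close>.
\<close>

definition dual_basis :: "('k::field \<Rightarrow> 'v::ab_group_add \<Rightarrow> 'v) \<Rightarrow> 'v set \<Rightarrow> 'v \<Rightarrow> ('v \<Rightarrow> 'k)"
  where "dual_basis sV B b = (\<lambda>v. module.representation sV B v b)"

definition hom_tensor ::
  "('k::field \<Rightarrow> 'v::ab_group_add \<Rightarrow> 'v) \<Rightarrow> 'v set \<Rightarrow> ('v \<Rightarrow> 'a::ab_group_add) \<Rightarrow>
   (('a \<times> ('v \<Rightarrow> 'k)) \<times> ('a \<times> ('v \<Rightarrow> 'k)) \<Rightarrow>\<^sub>0 'k)"
  where "hom_tensor sV B T = (\<Sum>b\<in>B. pure2 (T b, 0) (0, dual_basis sV B b))"

end

theory Submission
  imports Defs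
begin

text \<open>
  A formal combination of triples represents zero in the threefold tensor product exactly when
  every trilinear form kills it (\<open>tensor_null3_iff_trilinear\<close>): a combination outside the span of
  the multilinearity relations is separated from that span by a linear functional, and such a
  functional restricts to a trilinear form on pure tensors. So the Yang-Baxter equation for
  \<open>r = T - \<tau>(T)\<close> may be tested on an arbitrary trilinear form \<open>\<phi>\<close> on the carrier \<open>A \<oplus> V*\<close>.

  Expanding \<open>r\<close> over a basis of \<open>V\<close> turns the Yang-Baxter expression into a sum of terms each
  having one entry in \<open>A\<close> and two in \<open>V*\<close>, because products of two functionals vanish in the
  semi-direct product. In each term an action occurs either not at all, or as a transpose applied
  to a dual basis vector. The element \<open>\<Sum>\<^sub>b b \<otimes> b*\<close> of \<open>V \<otimes> V*\<close> is balanced for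
  transposition, \<open>\<Sum>\<^sub>b b \<otimes> f*(b*) = \<Sum>\<^sub>b f(b) \<otimes> b*\<close>, so the transposes can be moved into the
  argument of \<open>T\<close>. Writing
  \<open>D\<^sub>\<succ>(u, v) = T u \<succ> T v - T(l\<^sub>\<succ>(T u) v + r\<^sub>\<succ>(T v) u)\<close>,
  and \<open>D\<^sub>\<prec>\<close> alike for the other product, the terms collect into
  \<open>\<Sum>\<^sub>b\<^sub>,\<^sub>c (D\<^sub>\<succ> + D\<^sub>\<prec>)(b, c) \<otimes> b* \<otimes> c* - b* \<otimes> D\<^sub>\<succ>(c, b) \<otimes> c* - b* \<otimes> c* \<otimes> D\<^sub>\<prec>(b, c)\<close>
  (\<open>formal_eval_yang_baxter\<close>). If \<open>T\<close> is an O-operator both defects vanish and so does this sum.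
  Conversely the three summands lie in the independent components \<open>A \<otimes> V* \<otimes> V*\<close>,
  \<open>V* \<otimes> A \<otimes> V*\<close> and \<open>V* \<otimes> V* \<otimes> A\<close>, and the last two already determine the defects: test
  with the product of two evaluations on \<open>V*\<close> and a linear form on \<open>A\<close>. Skew-symmetry
  of \<open>r\<close> is automatic, since the flip is an involution.
\<close>

section \<open>Formal combinations and their evaluations\<close>

text \<open>
  The linear extension to formal combinations of a function given on the generators. Equalities
  between tensor representatives are proved by comparing all these extensions.
\<close>

definition formal_eval :: "('b \<Rightarrow> 'k::field) \<Rightarrow> ('b \<Rightarrow>\<^sub>0 'k) \<Rightarrow> 'k"
  where "formal_eval \<phi> t = (\<Sum>x\<in>Poly_Mapping.keys t. Poly_Mapping.lookup t x * \<phi> x)"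

lemma formal_eval_superset:
  assumes "finite X" "Poly_Mapping.keys t \<subseteq> X"
  shows "formal_eval \<phi> t = (\<Sum>x\<in>X. Poly_Mapping.lookup t x * \<phi> x)"
  unfolding formal_eval_def
  by (rule sum.mono_neutral_left) (use assms in \<open>auto simp: in_keys_iff\<close>)

lemma formal_eval_zero [simp]: "formal_eval \<phi> 0 = 0"
  by (simp add: formal_eval_def)

lemma formal_eval_add [simp]: "formal_eval \<phi> (s + t) = formal_eval \<phi> s + formal_eval \<phi> t"
proof -
  let ?X = "Poly_Mapping.keys s \<union> Poly_Mapping.keys t"
  have "Poly_Mapping.keys (s + t) \<subseteq> ?X" by (rule keys_add)
  then show ?thesis
    by (simp add: formal_eval_superset[of ?X] lookup_add distrib_right sum.distrib)
qed

lemma formal_eval_uminus [simp]: "formal_eval \<phi> (- t) = - formal_eval \<phi> t"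
proof -
  have "formal_eval \<phi> (- t) + formal_eval \<phi> t = formal_eval \<phi> (- t + t)"
    by (simp only: formal_eval_add)
  then show ?thesis by (simp add: eq_neg_iff_add_eq_0)
qed

lemma formal_eval_diff [simp]: "formal_eval \<phi> (s - t) = formal_eval \<phi> s - formal_eval \<phi> t"
  using formal_eval_add[of \<phi> s "- t"] by (simp only: formal_eval_uminus diff_conv_add_uminus)

lemma formal_eval_sum: "formal_eval \<phi> (\<Sum>i\<in>I. f i) = (\<Sum>i\<in>I. formal_eval \<phi> (f i))"
  by (induction I rule: infinite_finite_induct) auto

lemma formal_eval_single [simp]: "formal_eval \<phi> (Poly_Mapping.single x c) = c * \<phi> x"
  by (simp add: formal_eval_def)

lemma formal_eval_pure2 [simp]: "formal_eval \<phi> (pure2 a b) = \<phi> (a, b)"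
  by (simp add: pure2_def)

lemma formal_eval_pure3 [simp]: "formal_eval \<phi> (pure3 a b c) = \<phi> (a, b, c)"
  by (simp add: pure3_def)

lemma lookup_formal_scale [simp]:
  "Poly_Mapping.lookup (formal_scale c t) x = c * Poly_Mapping.lookup t x"
  by (simp add: formal_scale_def Poly_Mapping.map.rep_eq when_def)

lemma formal_eval_scale [simp]: "formal_eval \<phi> (formal_scale c t) = c * formal_eval \<phi> t"
proof -
  have "Poly_Mapping.keys (formal_scale c t) \<subseteq> Poly_Mapping.keys t"
    by (auto simp: in_keys_iff)
  then show ?thesis
    by (simp add: formal_eval_superset[of "Poly_Mapping.keys t"] sum_distrib_left mult.assoc)
qed

lemma lookup_eq_formal_eval:
  "Poly_Mapping.lookup t x = formal_eval (\<lambda>y. if y = x then 1 else 0) t"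
  by (subst formal_eval_superset[of "insert x (Poly_Mapping.keys t)"])
    (auto simp: if_distrib[of "(*) _"] sum.delta cong: if_cong)

lemma formal_eval_eqI:
  assumes "\<And>\<phi>. formal_eval \<phi> s = formal_eval \<phi> t"
  shows "s = t"
  by (rule poly_mapping_eqI) (simp only: lookup_eq_formal_eval assms)

lemma vector_space_formal_scale:
  "vector_space (formal_scale :: 'k::field \<Rightarrow> ('b \<Rightarrow>\<^sub>0 'k) \<Rightarrow> ('b \<Rightarrow>\<^sub>0 'k))"
  by unfold_locales (auto intro!: poly_mapping_eqI simp: lookup_add algebra_simps)

lemma formal_eval_tensor_flip [simp]:
  "formal_eval \<phi> (tensor_flip r) = formal_eval (\<lambda>(a, b). \<phi> (b, a)) r"
  unfolding tensor_flip_def formal_eval_sum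
  by (simp add: formal_eval_def[of _ r] case_prod_beta)

text \<open>
  The double sum is quadratic in \<open>r\<close>; nesting two evaluations makes it linear in each copy
  separately, so each copy can be expanded over the basis on its own.
\<close>

lemma formal_eval_double_sum:
  "formal_eval \<phi> (tensor_double_sum g r) = formal_eval (\<lambda>p. formal_eval (\<lambda>q. \<phi> (g p q)) r) r"
  unfolding tensor_double_sum_def formal_eval_sum
  by (simp add: formal_eval_def[of _ r] sum_distrib_left mult.assoc)

lemma tensor_flip_diff_flip: "tensor_flip (h - tensor_flip h) = - (h - tensor_flip h)"
  by (rule formal_eval_eqI) simp

section \<open>Linear and trilinear forms on a carrier\<close>

definition linear_form_on :: "('k::field \<Rightarrow> 'w::ab_group_add \<Rightarrow> 'w) \<Rightarrow> 'w set \<Rightarrow> ('w \<Rightarrow> 'k) \<Rightarrow> bool"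
  where "linear_form_on s S f \<longleftrightarrow>
    (\<forall>a\<in>S. \<forall>b\<in>S. f (a + b) = f a + f b) \<and> (\<forall>c. \<forall>a\<in>S. f (s c a) = c * f a)"

definition trilinear_form_on ::
  "('k::field \<Rightarrow> 'w::ab_group_add \<Rightarrow> 'w) \<Rightarrow> 'w set \<Rightarrow> ('w \<times> 'w \<times> 'w \<Rightarrow> 'k) \<Rightarrow> bool"
  where "trilinear_form_on s S \<phi> \<longleftrightarrow>
    (\<forall>b\<in>S. \<forall>c\<in>S. linear_form_on s S (\<lambda>a. \<phi> (a, b, c))) \<and>
    (\<forall>a\<in>S. \<forall>c\<in>S. linear_form_on s S (\<lambda>b. \<phi> (a, b, c))) \<and>
    (\<forall>a\<in>S. \<forall>b\<in>S. linear_form_on s S (\<lambda>c. \<phi> (a, b, c)))"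

lemma trilinear_form_onD:
  assumes "trilinear_form_on s S \<phi>" "a \<in> S" "b \<in> S" "c \<in> S"
  shows "a' \<in> S \<Longrightarrow> \<phi> (a + a', b, c) = \<phi> (a, b, c) + \<phi> (a', b, c)"
    and "b' \<in> S \<Longrightarrow> \<phi> (a, b + b', c) = \<phi> (a, b, c) + \<phi> (a, b', c)"
    and "c' \<in> S \<Longrightarrow> \<phi> (a, b, c + c') = \<phi> (a, b, c) + \<phi> (a, b, c')"
    and "\<phi> (s k a, b, c) = k * \<phi> (a, b, c)"
    and "\<phi> (a, s k b, c) = k * \<phi> (a, b, c)"
    and "\<phi> (a, b, s k c) = k * \<phi> (a, b, c)"
  using assms unfolding trilinear_form_on_def linear_form_on_def by blast+

lemma linear_form_on_zero:
  assumes "linear_form_on s S f" "0 \<in> S"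
  shows "f 0 = 0"
proof -
  have "f (0 + 0) = f 0 + f 0" using assms unfolding linear_form_on_def by blast
  then show ?thesis by (metis add_0 add_left_cancel add.right_neutral)
qed

lemma linear_form_on_uminus:
  assumes "linear_form_on s S f" "0 \<in> S" "a \<in> S" "- a \<in> S"
  shows "f (- a) = - f a"
proof -
  have "f (- a + a) = f (- a) + f a" using assms unfolding linear_form_on_def by blast
  then show ?thesis using linear_form_on_zero[OF assms(1,2)] by (simp add: eq_neg_iff_add_eq_0)
qed

lemma linear_form_on_combination:
  assumes "vector_space s" "module.subspace s S" "linear_form_on s S f" "\<And>i. i \<in> I \<Longrightarrow> w i \<in> S"
  shows "f (\<Sum>i\<in>I. s (c i) (w i)) = (\<Sum>i\<in>I. c i * f (w i))"
proof -
  interpret vector_space s by (rule assms(1))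
  have f: "f (a + b) = f a + f b" "f (s k a) = k * f a" if "a \<in> S" "b \<in> S" for a b k
    using assms(3) that by (auto simp: linear_form_on_def)
  have f0: "f 0 = 0" using linear_form_on_zero assms(2,3) subspace_0 by blast
  show ?thesis using assms(4)
  proof (induction I rule: infinite_finite_induct)
    case (insert i I)
    then have "s (c i) (w i) \<in> S" "(\<Sum>i\<in>I. s (c i) (w i)) \<in> S"
      using assms(2) by (auto intro!: subspace_sum subspace_scale)
    with insert show ?case by (simp add: f)
  qed (auto simp: f0)
qed

text \<open>
  A basis of the span of \<open>R\<close> stays independent when \<open>t\<close> is added, so the functional can be
  prescribed freely on both.
\<close>

lemma separating_functional:
  fixes s :: "'k::field \<Rightarrow> 'w::ab_group_add \<Rightarrow> 'w"
  assumes "vector_space s" "t \<notin> module.span s R"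
  obtains L where "linear_form_on s UNIV L" "\<And>x. x \<in> R \<Longrightarrow> L x = 0" "L t = 1"
proof -
  interpret W: vector_space s by (rule assms(1))
  interpret P: vector_space_pair s "(*) :: 'k \<Rightarrow> 'k \<Rightarrow> 'k"
    by unfold_locales (auto simp: algebra_simps)
  obtain B where B: "B \<subseteq> R" "W.independent B" "R \<subseteq> W.span B"
    using W.maximal_independent_subset by blast
  then have "W.span B = W.span R"
    by (meson W.span_eq W.span_superset subset_trans)
  with assms(2) have t: "t \<notin> W.span B" by simp
  then have "t \<notin> B" using W.span_base by blast
  have "W.independent (insert t B)" using B(2) t by (simp add: W.independent_insert)
  then obtain L where L: "Vector_Spaces.linear s (*) L"
      "\<forall>x\<in>insert t B. L x = (if x = t then 1 else 0)"
    using P.linear_independent_extend[of "insert t B" "\<lambda>x. if x = t then 1 else 0"] by blast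
  interpret L: Vector_Spaces.linear s "(*)" L by (rule L(1))
  have "L x = 0" if "x \<in> R" for x
    by (rule L.eq_0_on_span[of B]) (use L(2) \<open>t \<notin> B\<close> B(3) that in auto)
  moreover have "linear_form_on s UNIV L"
    by (simp add: linear_form_on_def L.add L.scale)
  ultimately show thesis using that L(2) by simp
qed

lemma tensor_null3_generators:
  fixes s :: "'k::field \<Rightarrow> 'w::ab_group_add \<Rightarrow> 'w"
  assumes "a \<in> S" "b \<in> S" "c \<in> S" "d \<in> S"
  shows "pure3 (a + d) b c - pure3 a b c - pure3 d b c \<in> tensor_null3 s S"
    and "pure3 a (b + d) c - pure3 a b c - pure3 a d c \<in> tensor_null3 s S"
    and "pure3 a b (c + d) - pure3 a b c - pure3 a b d \<in> tensor_null3 s S"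
    and "pure3 (s k a) b c - formal_scale k (pure3 a b c) \<in> tensor_null3 s S"
    and "pure3 a (s k b) c - formal_scale k (pure3 a b c) \<in> tensor_null3 s S"
    and "pure3 a b (s k c) - formal_scale k (pure3 a b c) \<in> tensor_null3 s S"
proof -
  interpret F: vector_space "formal_scale :: 'k \<Rightarrow> ('w \<times> 'w \<times> 'w \<Rightarrow>\<^sub>0 'k) \<Rightarrow> _"
    by (rule vector_space_formal_scale)
  show "pure3 (a + d) b c - pure3 a b c - pure3 d b c \<in> tensor_null3 s S"
    unfolding tensor_null3_def
    by (rule F.span_base, rule UnI1, rule UnI1, rule UnI1, rule UnI1, rule UnI1,
        intro CollectI exI conjI, rule refl) (rule assms)+
  show "pure3 a (b + d) c - pure3 a b c - pure3 a d c \<in> tensor_null3 s S"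
    unfolding tensor_null3_def
    by (rule F.span_base, rule UnI1, rule UnI1, rule UnI1, rule UnI1, rule UnI2,
        intro CollectI exI conjI, rule refl) (rule assms)+
  show "pure3 a b (c + d) - pure3 a b c - pure3 a b d \<in> tensor_null3 s S"
    unfolding tensor_null3_def
    by (rule F.span_base, rule UnI1, rule UnI1, rule UnI1, rule UnI2,
        intro CollectI exI conjI, rule refl) (rule assms)+
  show "pure3 (s k a) b c - formal_scale k (pure3 a b c) \<in> tensor_null3 s S"
    unfolding tensor_null3_def
    by (rule F.span_base, rule UnI1, rule UnI1, rule UnI2,
        intro CollectI exI conjI, rule refl) (rule assms)+
  show "pure3 a (s k b) c - formal_scale k (pure3 a b c) \<in> tensor_null3 s S"
    unfolding tensor_null3_def
    by (rule F.span_base, rule UnI1, rule UnI2,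
        intro CollectI exI conjI, rule refl) (rule assms)+
  show "pure3 a b (s k c) - formal_scale k (pure3 a b c) \<in> tensor_null3 s S"
    unfolding tensor_null3_def
    by (rule F.span_base, rule UnI2,
        intro CollectI exI conjI, rule refl) (rule assms)+
qed

text \<open>
  The universal property of the tensor product, in the form that trilinear forms with values in
  the field suffice to detect zero. The separating functional
  lives on the free space on triples, and vanishing on the relations is precisely trilinearity
  of its restriction to the pure triples.
\<close>

theorem tensor_null3_iff_trilinear:
  fixes s :: "'k::field \<Rightarrow> 'w::ab_group_add \<Rightarrow> 'w"
  shows "t \<in> tensor_null3 s S \<longleftrightarrow> (\<forall>\<phi>. trilinear_form_on s S \<phi> \<longrightarrow> formal_eval \<phi> t = 0)"
proof
  interpret F: vector_space "formal_scale :: 'k \<Rightarrow> ('w \<times> 'w \<times> 'w \<Rightarrow>\<^sub>0 'k) \<Rightarrow> _"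
    by (rule vector_space_formal_scale)
  {
    assume t: "t \<in> tensor_null3 s S"
    show "\<forall>\<phi>. trilinear_form_on s S \<phi> \<longrightarrow> formal_eval \<phi> t = 0"
    proof (intro allI impI)
      fix \<phi> assume \<phi>: "trilinear_form_on s S \<phi>"
      have "F.subspace {t. formal_eval \<phi> t = 0}"
        by (simp add: F.subspace_def)
      then have "tensor_null3 s S \<subseteq> {t. formal_eval \<phi> t = 0}"
        unfolding tensor_null3_def
        by (rule F.span_minimal[rotated])
          (auto simp: trilinear_form_onD[OF \<phi>])
      with t show "formal_eval \<phi> t = 0" by blast
    qed
  }
  {
    assume all: "\<forall>\<phi>. trilinear_form_on s S \<phi> \<longrightarrow> formal_eval \<phi> t = 0"
    show "t \<in> tensor_null3 s S"
    proof (rule ccontr)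
      assume "t \<notin> tensor_null3 s S"
      then obtain L where L: "linear_form_on formal_scale UNIV L" "L t = 1"
        and null: "\<And>x. x \<in> tensor_null3 s S \<Longrightarrow> L x = 0"
        using separating_functional[OF vector_space_formal_scale, of t "tensor_null3 s S"]
        unfolding tensor_null3_def F.span_span by blast
      have Ladd: "L (x + y) = L x + L y" and Lscale: "L (formal_scale c x) = c * L x" for x y c
        using L(1) by (auto simp: linear_form_on_def)
      have Ldiff: "L (x - y) = L x - L y" for x y
        using Ladd[of "x - y" y] by simp
      let ?\<phi> = "\<lambda>(a, b, c). L (pure3 a b c)"
      have add: "L x = L y + L z" if "x - y - z \<in> tensor_null3 s S" for x y z
        using null[OF that] by (simp add: Ldiff Ladd algebra_simps)
      have scale: "L x = k * L y" if "x - formal_scale k y \<in> tensor_null3 s S" for x y k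
        using null[OF that] by (simp add: Ldiff Lscale)
      have "trilinear_form_on s S ?\<phi>"
      proof -
        have "L (pure3 (a + d) b c) = L (pure3 a b c) + L (pure3 d b c)"
          "L (pure3 b (a + d) c) = L (pure3 b a c) + L (pure3 b d c)"
          "L (pure3 b c (a + d)) = L (pure3 b c a) + L (pure3 b c d)"
          if "a \<in> S" "b \<in> S" "c \<in> S" "d \<in> S" for a b c d
          by (auto intro: add tensor_null3_generators that)
        moreover have "L (pure3 (s k a) b c) = k * L (pure3 a b c)"
          "L (pure3 b (s k a) c) = k * L (pure3 b a c)"
          "L (pure3 b c (s k a)) = k * L (pure3 b c a)"
          if "a \<in> S" "b \<in> S" "c \<in> S" for k a b c
          by (auto intro: scale tensor_null3_generators that)
        ultimately show ?thesis
          by (simp add: trilinear_form_on_def linear_form_on_def)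
      qed
      then have "formal_eval ?\<phi> t = 0" using all by blast
      moreover have "formal_eval ?\<phi> t = L t"
      proof -
        have "t = (\<Sum>x\<in>Poly_Mapping.keys t.
            formal_scale (Poly_Mapping.lookup t x) (Poly_Mapping.single x 1))"
          by (rule formal_eval_eqI)
              (simp add: formal_eval_sum formal_eval_def[of _ t])
        then have "L t = L (\<Sum>x\<in>Poly_Mapping.keys t.
            formal_scale (Poly_Mapping.lookup t x) (Poly_Mapping.single x 1))"
          by (rule arg_cong)
        also have "\<dots> = (\<Sum>x\<in>Poly_Mapping.keys t.
            Poly_Mapping.lookup t x * L (Poly_Mapping.single x 1))"
          by (rule linear_form_on_combination[OF vector_space_formal_scale F.subspace_UNIV L(1)]) simp
        finally show ?thesis
          by (simp add: formal_eval_def pure3_def case_prod_beta)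
      qed
      ultimately show False using L(2) by simp
    qed
  }
qed

section \<open>Contraction with dual bases\<close>

lemma sum_fun_apply: "(\<Sum>i\<in>I. f i) x = (\<Sum>i\<in>I. f i x)"
  by (induction I rule: infinite_finite_induct) auto

context finite_dimensional_vector_space
begin

lemma dual_basis_expansion: "(\<Sum>b\<in>Basis. scale (dual_basis scale Basis b v) b) = v"
  unfolding dual_basis_def
  by (rule sum_representation_eq) (auto simp: independent_Basis span_Basis finite_Basis)

lemma dual_basis_in_dual_space: "dual_basis scale Basis b \<in> dual_space scale"
  by (simp add: dual_space_iff[OF vector_space_axioms] dual_basis_def
      representation_add representation_scale independent_Basis span_Basis)

lemma dual_space_expansion:
  assumes "u \<in> dual_space scale"
  shows "u = (\<Sum>b\<in>Basis. dual_scale (u b) (dual_basis scale Basis b))"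
proof
  fix v
  have "linear_form_on scale UNIV u"
    using assms by (simp add: linear_form_on_def dual_space_iff[OF vector_space_axioms])
  from linear_form_on_combination[OF vector_space_axioms subspace_UNIV this,
      of Basis "\<lambda>b. b" "\<lambda>b. dual_basis scale Basis b v"]
  have "u v = (\<Sum>b\<in>Basis. dual_basis scale Basis b v * u b)"
    by (simp add: dual_basis_expansion)
  then show "u v = (\<Sum>b\<in>Basis. dual_scale (u b) (dual_basis scale Basis b)) v"
    by (simp add: dual_scale_def sum_fun_apply mult.commute)
qed

text \<open>
  The canonical element \<open>\<Sum>\<^sub>b b \<otimes> b*\<close> is balanced: expanding \<open>f*(b*)\<close> in the dual basis and
  \<open>f(b)\<close> in the basis yields the same matrix coefficients \<open>b*(f c)\<close> on both sides. This is what
  trades the dual representation in \<open>A \<ltimes> V*\<close> for the original one inside \<open>T\<close>.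
\<close>

lemma dual_basis_contraction:
  assumes f: "Vector_Spaces.linear scale scale (f x)"
    and V: "\<And>u. u \<in> dual_space scale \<Longrightarrow> linear_form_on scale UNIV (\<lambda>v. \<psi> v u)"
    and D: "\<And>v. linear_form_on dual_scale (dual_space scale) (\<psi> v)"
  shows "(\<Sum>b\<in>Basis. \<psi> b (dual_map f x (dual_basis scale Basis b))) =
    (\<Sum>b\<in>Basis. \<psi> (f x b) (dual_basis scale Basis b))"
proof -
  let ?d = "dual_basis scale Basis"
  interpret f: Vector_Spaces.linear scale scale "f x" by (rule f)
  have d: "?d b (v + w) = ?d b v + ?d b w" "?d b (scale c v) = c * ?d b v" for b v w c
    using dual_basis_in_dual_space by (auto simp: dual_space_iff[OF vector_space_axioms])
  have df: "dual_map f x (?d b) \<in> dual_space scale" for b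
    by (simp add: dual_space_iff[OF vector_space_axioms] dual_map_def f.add f.scale d)
  have "(\<Sum>b\<in>Basis. \<psi> b (dual_map f x (?d b))) = (\<Sum>b\<in>Basis. \<Sum>c\<in>Basis. ?d b (f x c) * \<psi> b (?d c))"
  proof (rule sum.cong[OF refl])
    fix b
    have "\<psi> b (dual_map f x (?d b)) = \<psi> b (\<Sum>c\<in>Basis. dual_scale (?d b (f x c)) (?d c))"
      by (subst dual_space_expansion[OF df]) (simp add: dual_map_def)
    also have "\<dots> = (\<Sum>c\<in>Basis. ?d b (f x c) * \<psi> b (?d c))"
      by (rule linear_form_on_combination[OF vector_space_dual_scale
            subspace_dual_space[OF vector_space_axioms] D dual_basis_in_dual_space])
    finally show "\<psi> b (dual_map f x (?d b)) = (\<Sum>c\<in>Basis. ?d b (f x c) * \<psi> b (?d c))" .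
  qed
  also have "\<dots> = (\<Sum>c\<in>Basis. \<Sum>b\<in>Basis. ?d b (f x c) * \<psi> b (?d c))"
    by (rule sum.swap)
  also have "\<dots> = (\<Sum>c\<in>Basis. \<psi> (f x c) (?d c))"
  proof (rule sum.cong[OF refl])
    fix c
    show "(\<Sum>b\<in>Basis. ?d b (f x c) * \<psi> b (?d c)) = \<psi> (f x c) (?d c)"
      using linear_form_on_combination[OF vector_space_axioms subspace_UNIV
          V[OF dual_basis_in_dual_space], of Basis "\<lambda>b. b" "\<lambda>b. ?d b (f x c)" c]
      by (simp add: dual_basis_expansion)
  qed
  finally show ?thesis .
qed

end

section \<open>The Yang-Baxter expression of an operator\<close>

locale operator_into_semidirect_product =
  V: finite_dimensional_vector_space sV BV + A: vector_space sA
  for sA :: "'k::field \<Rightarrow> 'a::ab_group_add \<Rightarrow> 'a"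
    and sV :: "'k \<Rightarrow> 'v::ab_group_add \<Rightarrow> 'v" and BV :: "'v set" +
  fixes succ prec :: "'a \<Rightarrow> 'a \<Rightarrow> 'a"
    and lsucc rsucc lprec rprec :: "'a \<Rightarrow> 'v \<Rightarrow> 'v"
    and T :: "'v \<Rightarrow> 'a"
  assumes bilinear_products: "bilinear_on sA UNIV sA UNIV sA UNIV succ"
      "bilinear_on sA UNIV sA UNIV sA UNIV prec"
    and bilinear_actions: "bilinear_on sA UNIV sV UNIV sV UNIV lsucc"
      "bilinear_on sA UNIV sV UNIV sV UNIV rsucc"
      "bilinear_on sA UNIV sV UNIV sV UNIV lprec"
      "bilinear_on sA UNIV sV UNIV sV UNIV rprec"
    and linear_T: "Vector_Spaces.linear sV sA T"
begin

abbreviation carrier :: "('a \<times> ('v \<Rightarrow> 'k)) set"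
  where "carrier \<equiv> UNIV \<times> dual_space sV"

abbreviation scale :: "'k \<Rightarrow> 'a \<times> ('v \<Rightarrow> 'k) \<Rightarrow> 'a \<times> ('v \<Rightarrow> 'k)"
  where "scale \<equiv> semidirect_scale sA dual_scale"

definition hsucc :: "'a \<times> ('v \<Rightarrow> 'k) \<Rightarrow> 'a \<times> ('v \<Rightarrow> 'k) \<Rightarrow> 'a \<times> ('v \<Rightarrow> 'k)"
  where "hsucc = semidirect_prod succ (- (dual_map rprec + dual_map rsucc)) (dual_map lprec)"

definition hprec :: "'a \<times> ('v \<Rightarrow> 'k) \<Rightarrow> 'a \<times> ('v \<Rightarrow> 'k) \<Rightarrow> 'a \<times> ('v \<Rightarrow> 'k)"
  where "hprec = semidirect_prod prec (dual_map rsucc) (- (dual_map lprec + dual_map lsucc))"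

abbreviation dual :: "'v \<Rightarrow> 'v \<Rightarrow> 'k"
  where "dual \<equiv> dual_basis sV BV"

definition skew_tensor :: "('a \<times> ('v \<Rightarrow> 'k)) \<times> ('a \<times> ('v \<Rightarrow> 'k)) \<Rightarrow>\<^sub>0 'k"
  where "skew_tensor = hom_tensor sV BV T - tensor_flip (hom_tensor sV BV T)"

definition yang_baxter ::
    "('a \<times> ('v \<Rightarrow> 'k)) \<times> ('a \<times> ('v \<Rightarrow> 'k)) \<times> ('a \<times> ('v \<Rightarrow> 'k)) \<Rightarrow>\<^sub>0 'k"
  where "yang_baxter = r12_r13 (hsucc + hprec) skew_tensor + r23_r12 hsucc skew_tensor
    - r13_r23 hprec skew_tensor"

text \<open>
  \<open>T\<close> is an O-operator iff both of these failures of the operator identities vanish.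
\<close>

definition defect_succ :: "'v \<Rightarrow> 'v \<Rightarrow> 'a"
  where "defect_succ u v = succ (T u) (T v) - T (lsucc (T u) v + rsucc (T v) u)"

definition defect_prec :: "'v \<Rightarrow> 'v \<Rightarrow> 'a"
  where "defect_prec u v = prec (T u) (T v) - T (lprec (T u) v + rprec (T v) u)"

lemma O_operator_iff_defects:
  "O_operator sA succ prec sV lsucc rsucc lprec rprec T \<longleftrightarrow>
    (\<forall>u v. defect_succ u v = 0) \<and> (\<forall>u v. defect_prec u v = 0)"
  by (simp add: O_operator_def defect_succ_def defect_prec_def linear_T)

lemma T_add: "T (v + w) = T v + T w" and T_scale: "T (sV c v) = sA c (T v)"
proof -
  interpret T: Vector_Spaces.linear sV sA T by (rule linear_T)
  show "T (v + w) = T v + T w" "T (sV c v) = sA c (T v)" by (rule T.add, rule T.scale)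
qed

lemma linear_action:
  assumes "bilinear_on sA UNIV sV UNIV sV UNIV f"
  shows "Vector_Spaces.linear sV sV (f x)"
proof -
  have "f x (v + w) = f x v + f x w" "f x (sV c v) = sV c (f x v)" for v w c
    using assms unfolding bilinear_on_def by blast+
  then show ?thesis by unfold_locales
qed

lemmas linear_actions = bilinear_actions[THEN linear_action]

lemma products_zero: "succ 0 x = 0" "succ x 0 = 0" "prec 0 x = 0" "prec x 0 = 0"
proof -
  have "succ (y + z) x = succ y x + succ z x" "succ x (y + z) = succ x y + succ x z"
    "prec (y + z) x = prec y x + prec z x" "prec x (y + z) = prec x y + prec x z" for y z
    using bilinear_products by (auto simp: bilinear_on_def)
  from this[of 0 0] show "succ 0 x = 0" "succ x 0 = 0" "prec 0 x = 0" "prec x 0 = 0" by simp_all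
qed

lemma dual_in_dual_space [simp]: "dual b \<in> dual_space sV"
  by (rule V.dual_basis_in_dual_space)

lemma zero_in_dual_space [simp]: "0 \<in> dual_space sV"
  by (simp add: dual_space_iff[OF V.vector_space_axioms])

lemma dual_map_in_dual_space:
  assumes "Vector_Spaces.linear sV sV (f x)" "u \<in> dual_space sV"
  shows "dual_map f x u \<in> dual_space sV"
proof -
  interpret f: Vector_Spaces.linear sV sV "f x" by (rule assms(1))
  show ?thesis
    using assms(2) by (simp add: dual_space_iff[OF V.vector_space_axioms] dual_map_def f.add f.scale)
qed

lemmas dual_actions_in_dual_space [simp] = linear_actions[THEN dual_map_in_dual_space]

lemma dual_space_diff [simp]:
    "u \<in> dual_space sV \<Longrightarrow> w \<in> dual_space sV \<Longrightarrow> u - w \<in> dual_space sV"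
  and dual_space_uminus [simp]: "u \<in> dual_space sV \<Longrightarrow> - u \<in> dual_space sV"
  by (simp_all add: dual_space_iff[OF V.vector_space_axioms] algebra_simps)

lemma dual_map_zero: "dual_map f x 0 = 0"
  by (simp add: dual_map_def fun_eq_iff)

lemma dual_map_at_zero:
  assumes "bilinear_on sA UNIV sV UNIV sV UNIV f" "u \<in> dual_space sV"
  shows "dual_map f 0 u = 0"
proof
  fix v
  have "f (0 + 0) v = f 0 v + f 0 v" using assms(1) unfolding bilinear_on_def by blast
  then have "f 0 v = 0" by simp
  moreover have "u (sV 0 0) = 0 * u 0"
    using assms(2) unfolding dual_space_iff[OF V.vector_space_axioms] by blast
  ultimately show "dual_map f 0 u v = 0 v" by (simp add: dual_map_def)
qed

lemmas dual_actions_at_zero = bilinear_actions[THEN dual_map_at_zero]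

lemma hat_products:
  "hsucc (x, 0) (y, 0) = (succ x y, 0)"
  "hprec (x, 0) (y, 0) = (prec x y, 0)"
  "u \<in> dual_space sV \<Longrightarrow> hsucc (x, 0) (0, u) = (0, - dual_map rprec x u - dual_map rsucc x u)"
  "u \<in> dual_space sV \<Longrightarrow> hsucc (0, u) (x, 0) = (0, dual_map lprec x u)"
  "u \<in> dual_space sV \<Longrightarrow> hprec (x, 0) (0, u) = (0, dual_map rsucc x u)"
  "u \<in> dual_space sV \<Longrightarrow> hprec (0, u) (x, 0) = (0, - dual_map lprec x u - dual_map lsucc x u)"
  "u \<in> dual_space sV \<Longrightarrow> w \<in> dual_space sV \<Longrightarrow> hsucc (0, u) (0, w) = 0"
  "u \<in> dual_space sV \<Longrightarrow> w \<in> dual_space sV \<Longrightarrow> hprec (0, u) (0, w) = 0"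
  by (simp_all add: hsucc_def hprec_def semidirect_prod_def products_zero dual_map_zero dual_actions_at_zero zero_prod_def)

text \<open>
  In the sum of the two products the \<open>r\<^sub>\<succ>*\<close> parts, respectively the \<open>l\<^sub>\<prec>*\<close> parts, cancel.
\<close>

lemma hat_dot_products:
  "(hsucc + hprec) (x, 0) (y, 0) = (succ x y + prec x y, 0)"
  "u \<in> dual_space sV \<Longrightarrow> (hsucc + hprec) (x, 0) (0, u) = (0, - dual_map rprec x u)"
  "u \<in> dual_space sV \<Longrightarrow> (hsucc + hprec) (0, u) (x, 0) = (0, - dual_map lsucc x u)"
  "u \<in> dual_space sV \<Longrightarrow> w \<in> dual_space sV \<Longrightarrow> (hsucc + hprec) (0, u) (0, w) = 0"
  by (simp_all only: plus_fun_apply hat_products) simp_all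

lemma formal_eval_skew_tensor:
  "formal_eval \<phi> skew_tensor =
    (\<Sum>b\<in>BV. \<phi> ((T b, 0), (0, dual b))) - (\<Sum>b\<in>BV. \<phi> ((0, dual b), (T b, 0)))"
  by (simp add: skew_tensor_def hom_tensor_def formal_eval_sum)

lemma linear_form_on_hat:
  assumes "linear_form_on scale carrier g"
  shows "g 0 = 0"
    and "\<lbrakk>u \<in> dual_space sV; w \<in> dual_space sV\<rbrakk> \<Longrightarrow> g (0, u - w) = g (0, u) - g (0, w)"
    and "u \<in> dual_space sV \<Longrightarrow> g (0, - u) = - g (0, u)"
    and "g (x + y, 0) = g (x, 0) + g (y, 0)"
    and "g (x - y, 0) = g (x, 0) - g (y, 0)"
    and "linear_form_on sV UNIV (\<lambda>v. g (T v, 0))"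
    and "linear_form_on dual_scale (dual_space sV) (\<lambda>u. g (0, u))"
proof -
  have add: "g (p + q) = g p + g q" if "p \<in> carrier" "q \<in> carrier" for p q
    using assms that unfolding linear_form_on_def by blast
  have scale: "g (scale c p) = c * g p" if "p \<in> carrier" for c p
    using assms that unfolding linear_form_on_def by blast
  have V: "g (0, u + w) = g (0, u) + g (0, w)" if "u \<in> dual_space sV" "w \<in> dual_space sV" for u w
    using add[of "(0, u)" "(0, w)"] that by simp
  have A: "g (x + y, 0) = g (x, 0) + g (y, 0)" for x y
    using add[of "(x, 0)" "(y, 0)"] by simp
  have z: "dual_scale c 0 = (0 :: 'v \<Rightarrow> 'k)" for c by (simp add: dual_scale_def fun_eq_iff)
  show "g 0 = 0"
    by (rule linear_form_on_zero[OF assms]) (simp add: zero_prod_def)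
  show "g (0, u - w) = g (0, u) - g (0, w)" if "u \<in> dual_space sV" "w \<in> dual_space sV"
    using V[of "u - w" w] that by simp
  show "g (0, - u) = - g (0, u)" if "u \<in> dual_space sV"
    using linear_form_on_uminus[OF assms, of "(0, u)"] that by (simp add: zero_prod_def)
  show "g (x + y, 0) = g (x, 0) + g (y, 0)" by (rule A)
  show "g (x - y, 0) = g (x, 0) - g (y, 0)" using A[of "x - y" y] by simp
  show "linear_form_on sV UNIV (\<lambda>v. g (T v, 0))"
    using scale[of "(T _, 0)"] by (simp add: linear_form_on_def T_add T_scale A semidirect_scale_def z)
  show "linear_form_on dual_scale (dual_space sV) (\<lambda>u. g (0, u))"
    using scale[of "(0, _)"] by (simp add: linear_form_on_def V semidirect_scale_def)
qed

text \<open>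
  The balancing of the canonical element, transported along \<open>T\<close> into the semi-direct product.
\<close>

lemma contraction:
  assumes "Vector_Spaces.linear sV sV (f x)"
    and "\<And>q. q \<in> carrier \<Longrightarrow> linear_form_on scale carrier (\<lambda>p. \<beta> p q)"
    and "\<And>p. p \<in> carrier \<Longrightarrow> linear_form_on scale carrier (\<lambda>q. \<beta> p q)"
  shows "(\<Sum>b\<in>BV. \<beta> (T b, 0) (0, dual_map f x (dual b))) =
    (\<Sum>b\<in>BV. \<beta> (T (f x b), 0) (0, dual b))"
proof (rule V.dual_basis_contraction[where f = f and x = x and \<psi> = "\<lambda>v u. \<beta> (T v, 0) (0, u)"])
  show "Vector_Spaces.linear sV sV (f x)" by (rule assms(1))
  show "linear_form_on sV UNIV (\<lambda>v. \<beta> (T v, 0) (0, u))" if "u \<in> dual_space sV" for u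
    by (rule linear_form_on_hat(6)[OF assms(2), of "(0, u)"]) (simp add: that)
  show "linear_form_on dual_scale (dual_space sV) (\<lambda>u. \<beta> (T v, 0) (0, u))" for v
    by (rule linear_form_on_hat(7)[OF assms(3), of "(T v, 0)"]) simp
qed

context
  fixes \<phi> assumes \<phi>: "trilinear_form_on scale carrier \<phi>"
begin

lemma slots:
  "b \<in> carrier \<Longrightarrow> c \<in> carrier \<Longrightarrow> linear_form_on scale carrier (\<lambda>a. \<phi> (a, b, c))"
  "a \<in> carrier \<Longrightarrow> c \<in> carrier \<Longrightarrow> linear_form_on scale carrier (\<lambda>b. \<phi> (a, b, c))"
  "a \<in> carrier \<Longrightarrow> b \<in> carrier \<Longrightarrow> linear_form_on scale carrier (\<lambda>c. \<phi> (a, b, c))"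
  using \<phi> unfolding trilinear_form_on_def by blast+

lemmas slot_linear = slots[THEN linear_form_on_hat(1)] slots[THEN linear_form_on_hat(2)]
  slots[THEN linear_form_on_hat(3)] slots[THEN linear_form_on_hat(4)]
  slots[THEN linear_form_on_hat(5)]

text \<open>
  The six ways of placing the contracted pair \<open>(T b, f*(b*))\<close> in two of the three tensor slots.
  The right-hand sides are reindexed so that the two functionals appear as \<open>b*\<close>, \<open>c*\<close> from
  left to right; this is the common shape in which the terms are collected.
\<close>

lemma contract_slots:
  assumes f: "\<And>x. Vector_Spaces.linear sV sV (f x)"
  shows "(\<Sum>b\<in>BV. \<Sum>c\<in>BV. \<phi> ((T b, 0), (0, dual_map f (T c) (dual b)), (0, dual c))) =
      (\<Sum>b\<in>BV. \<Sum>c\<in>BV. \<phi> ((T (f (T c) b), 0), (0, dual b), (0, dual c)))"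
    and "(\<Sum>b\<in>BV. \<Sum>c\<in>BV. \<phi> ((T b, 0), (0, dual c), (0, dual_map f (T c) (dual b)))) =
      (\<Sum>b\<in>BV. \<Sum>c\<in>BV. \<phi> ((T (f (T b) c), 0), (0, dual b), (0, dual c)))"
    and "(\<Sum>b\<in>BV. \<Sum>c\<in>BV. \<phi> ((0, dual_map f (T c) (dual b)), (T b, 0), (0, dual c))) =
      (\<Sum>b\<in>BV. \<Sum>c\<in>BV. \<phi> ((0, dual b), (T (f (T c) b), 0), (0, dual c)))"
    and "(\<Sum>b\<in>BV. \<Sum>c\<in>BV. \<phi> ((0, dual b), (T c, 0), (0, dual_map f (T b) (dual c)))) =
      (\<Sum>b\<in>BV. \<Sum>c\<in>BV. \<phi> ((0, dual b), (T (f (T b) c), 0), (0, dual c)))"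
    and "(\<Sum>b\<in>BV. \<Sum>c\<in>BV. \<phi> ((0, dual_map f (T b) (dual c)), (0, dual b), (T c, 0))) =
      (\<Sum>b\<in>BV. \<Sum>c\<in>BV. \<phi> ((0, dual b), (0, dual c), (T (f (T c) b), 0)))"
    and "(\<Sum>b\<in>BV. \<Sum>c\<in>BV. \<phi> ((0, dual b), (0, dual_map f (T b) (dual c)), (T c, 0))) =
      (\<Sum>b\<in>BV. \<Sum>c\<in>BV. \<phi> ((0, dual b), (0, dual c), (T (f (T b) c), 0)))"
proof -
  have q: "(0, dual c) \<in> carrier" for c by simp
  have 12: "(\<Sum>b\<in>BV. \<phi> ((T b, 0), (0, dual_map f x (dual b)), (0, dual c))) =
      (\<Sum>b\<in>BV. \<phi> ((T (f x b), 0), (0, dual b), (0, dual c)))" for x c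
    by (rule contraction[OF f, where \<beta> = "\<lambda>p q. \<phi> (p, q, (0, dual c))"])
      (rule slots; use q in blast)+
  have 13: "(\<Sum>b\<in>BV. \<phi> ((T b, 0), (0, dual c), (0, dual_map f x (dual b)))) =
      (\<Sum>b\<in>BV. \<phi> ((T (f x b), 0), (0, dual c), (0, dual b)))" for x c
    by (rule contraction[OF f, where \<beta> = "\<lambda>p q. \<phi> (p, (0, dual c), q)"])
      (rule slots; use q in blast)+
  have 21: "(\<Sum>b\<in>BV. \<phi> ((0, dual_map f x (dual b)), (T b, 0), (0, dual c))) =
      (\<Sum>b\<in>BV. \<phi> ((0, dual b), (T (f x b), 0), (0, dual c)))" for x c
    by (rule contraction[OF f, where \<beta> = "\<lambda>p q. \<phi> (q, p, (0, dual c))"])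
      (rule slots; use q in blast)+
  have 23: "(\<Sum>b\<in>BV. \<phi> ((0, dual c), (T b, 0), (0, dual_map f x (dual b)))) =
      (\<Sum>b\<in>BV. \<phi> ((0, dual c), (T (f x b), 0), (0, dual b)))" for x c
    by (rule contraction[OF f, where \<beta> = "\<lambda>p q. \<phi> ((0, dual c), p, q)"])
      (rule slots; use q in blast)+
  have 31: "(\<Sum>b\<in>BV. \<phi> ((0, dual_map f x (dual b)), (0, dual c), (T b, 0))) =
      (\<Sum>b\<in>BV. \<phi> ((0, dual b), (0, dual c), (T (f x b), 0)))" for x c
    by (rule contraction[OF f, where \<beta> = "\<lambda>p q. \<phi> (q, (0, dual c), p)"])
      (rule slots; use q in blast)+
  have 32: "(\<Sum>b\<in>BV. \<phi> ((0, dual c), (0, dual_map f x (dual b)), (T b, 0))) =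
      (\<Sum>b\<in>BV. \<phi> ((0, dual c), (0, dual b), (T (f x b), 0)))" for x c
    by (rule contraction[OF f, where \<beta> = "\<lambda>p q. \<phi> ((0, dual c), q, p)"])
      (rule slots; use q in blast)+
  show "(\<Sum>b\<in>BV. \<Sum>c\<in>BV. \<phi> ((T b, 0), (0, dual_map f (T c) (dual b)), (0, dual c))) =
      (\<Sum>b\<in>BV. \<Sum>c\<in>BV. \<phi> ((T (f (T c) b), 0), (0, dual b), (0, dual c)))"
    by (subst (1 2) sum.swap) (simp only: 12)
  show "(\<Sum>b\<in>BV. \<Sum>c\<in>BV. \<phi> ((T b, 0), (0, dual c), (0, dual_map f (T c) (dual b)))) =
      (\<Sum>b\<in>BV. \<Sum>c\<in>BV. \<phi> ((T (f (T b) c), 0), (0, dual b), (0, dual c)))"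
    by (subst sum.swap) (simp only: 13)
  show "(\<Sum>b\<in>BV. \<Sum>c\<in>BV. \<phi> ((0, dual_map f (T c) (dual b)), (T b, 0), (0, dual c))) =
      (\<Sum>b\<in>BV. \<Sum>c\<in>BV. \<phi> ((0, dual b), (T (f (T c) b), 0), (0, dual c)))"
    by (subst (1 2) sum.swap) (simp only: 21)
  show "(\<Sum>b\<in>BV. \<Sum>c\<in>BV. \<phi> ((0, dual b), (T c, 0), (0, dual_map f (T b) (dual c)))) =
      (\<Sum>b\<in>BV. \<Sum>c\<in>BV. \<phi> ((0, dual b), (T (f (T b) c), 0), (0, dual c)))"
    by (simp only: 23)
  show "(\<Sum>b\<in>BV. \<Sum>c\<in>BV. \<phi> ((0, dual_map f (T b) (dual c)), (0, dual b), (T c, 0))) =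
      (\<Sum>b\<in>BV. \<Sum>c\<in>BV. \<phi> ((0, dual b), (0, dual c), (T (f (T c) b), 0)))"
    by (subst (2) sum.swap) (simp only: 31)
  show "(\<Sum>b\<in>BV. \<Sum>c\<in>BV. \<phi> ((0, dual b), (0, dual_map f (T b) (dual c)), (T c, 0))) =
      (\<Sum>b\<in>BV. \<Sum>c\<in>BV. \<phi> ((0, dual b), (0, dual c), (T (f (T b) c), 0)))"
    by (simp only: 32)
qed

text \<open>
  Each of \<open>r\<^sub>1\<^sub>2 \<cdot> r\<^sub>1\<^sub>3\<close>, \<open>r\<^sub>2\<^sub>3 \<succ> r\<^sub>1\<^sub>2\<close> and \<open>r\<^sub>1\<^sub>3 \<prec> r\<^sub>2\<^sub>3\<close> supplies the bare product term of one of
  the three components, while the action terms of that component come from the other two.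
\<close>

lemma formal_eval_yang_baxter:
  "formal_eval \<phi> yang_baxter =
    (\<Sum>b\<in>BV. \<Sum>c\<in>BV. \<phi> ((defect_succ b c + defect_prec b c, 0), (0, dual b), (0, dual c))) -
    (\<Sum>b\<in>BV. \<Sum>c\<in>BV. \<phi> ((0, dual b), (defect_succ c b, 0), (0, dual c))) -
    (\<Sum>b\<in>BV. \<Sum>c\<in>BV. \<phi> ((0, dual b), (0, dual c), (defect_prec b c, 0)))"
proof -
  note expand = formal_eval_double_sum formal_eval_skew_tensor hat_products hat_dot_products
    slot_linear sum.distrib sum_subtractf sum_negf
  have r12: "formal_eval \<phi> (r12_r13 (hsucc + hprec) skew_tensor) =
      (\<Sum>b\<in>BV. \<Sum>c\<in>BV. \<phi> ((succ (T b) (T c), 0), (0, dual b), (0, dual c))) +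
      (\<Sum>b\<in>BV. \<Sum>c\<in>BV. \<phi> ((prec (T b) (T c), 0), (0, dual b), (0, dual c))) +
      (\<Sum>b\<in>BV. \<Sum>c\<in>BV. \<phi> ((0, dual_map rprec (T b) (dual c)), (0, dual b), (T c, 0))) +
      (\<Sum>b\<in>BV. \<Sum>c\<in>BV. \<phi> ((0, dual_map lsucc (T c) (dual b)), (T b, 0), (0, dual c)))"
    unfolding r12_r13_def by (simp add: expand del: plus_fun_apply)
  have r23: "formal_eval \<phi> (r23_r12 hsucc skew_tensor) =
      - (\<Sum>b\<in>BV. \<Sum>c\<in>BV. \<phi> ((T b, 0), (0, dual_map rprec (T c) (dual b)), (0, dual c)))
      - (\<Sum>b\<in>BV. \<Sum>c\<in>BV. \<phi> ((T b, 0), (0, dual_map rsucc (T c) (dual b)), (0, dual c)))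
      - (\<Sum>b\<in>BV. \<Sum>c\<in>BV. \<phi> ((0, dual b), (succ (T c) (T b), 0), (0, dual c)))
      + (\<Sum>b\<in>BV. \<Sum>c\<in>BV. \<phi> ((0, dual b), (0, dual_map lprec (T b) (dual c)), (T c, 0)))"
    unfolding r23_r12_def by (simp add: expand)
  have r13: "formal_eval \<phi> (r13_r23 hprec skew_tensor) =
      (\<Sum>b\<in>BV. \<Sum>c\<in>BV. \<phi> ((T b, 0), (0, dual c), (0, dual_map lprec (T c) (dual b))))
      + (\<Sum>b\<in>BV. \<Sum>c\<in>BV. \<phi> ((T b, 0), (0, dual c), (0, dual_map lsucc (T c) (dual b))))
      - (\<Sum>b\<in>BV. \<Sum>c\<in>BV. \<phi> ((0, dual b), (T c, 0), (0, dual_map rsucc (T b) (dual c))))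
      + (\<Sum>b\<in>BV. \<Sum>c\<in>BV. \<phi> ((0, dual b), (0, dual c), (prec (T b) (T c), 0)))"
    unfolding r13_r23_def by (simp add: expand)
  show ?thesis
    unfolding yang_baxter_def formal_eval_add formal_eval_diff r12 r23 r13
      linear_actions[THEN contract_slots(1)] linear_actions[THEN contract_slots(2)]
      linear_actions[THEN contract_slots(3)] linear_actions[THEN contract_slots(4)]
      linear_actions[THEN contract_slots(5)] linear_actions[THEN contract_slots(6)]
    by (simp add: defect_succ_def defect_prec_def T_add slot_linear sum.distrib sum_subtractf)
qed

end

lemma bilinear_defects:
  "bilinear_on sV UNIV sV UNIV sA UNIV defect_succ"
  "bilinear_on sV UNIV sV UNIV sA UNIV defect_prec"
proof -
  have b: "f (x + y) v = f x v + f y v" "f x (v + w) = f x v + f x w"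
    "f (sA k x) v = s k (f x v)" "f x (t k v) = s k (f x v)"
    if "bilinear_on sA UNIV t UNIV s UNIV f" for f t s x y v w k
    using that by (auto simp: bilinear_on_def)
  note simps = bilinear_products[THEN b(1)] bilinear_products[THEN b(2)]
    bilinear_products[THEN b(3)] bilinear_products[THEN b(4)]
    bilinear_actions[THEN b(1)] bilinear_actions[THEN b(2)]
    bilinear_actions[THEN b(3)] bilinear_actions[THEN b(4)]
  show "bilinear_on sV UNIV sV UNIV sA UNIV defect_succ"
    "bilinear_on sV UNIV sV UNIV sA UNIV defect_prec"
    by (simp_all add: bilinear_on_def defect_succ_def defect_prec_def T_add T_scale simps
        A.scale_right_diff_distrib A.scale_right_distrib)
qed

text \<open>
  The Yang-Baxter expression contains the defects at basis vectors weighted by dual basis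
  functionals; evaluating these functionals recovers the defects at arbitrary vectors.
\<close>

lemma bilinear_expansion:
  assumes d: "bilinear_on sV UNIV sV UNIV sA UNIV d" and \<alpha>: "linear_form_on sA UNIV \<alpha>"
  shows "(\<Sum>b\<in>BV. \<Sum>c\<in>BV. dual b v * dual c w * \<alpha> (d b c)) = \<alpha> (d v w)"
proof -
  have "linear_form_on sV UNIV (\<lambda>u. \<alpha> (d u q))" "linear_form_on sV UNIV (\<lambda>u. \<alpha> (d p u))" for p q
    using d \<alpha> by (simp_all add: bilinear_on_def linear_form_on_def)
  note lin = this[THEN linear_form_on_combination[OF V.vector_space_axioms V.subspace_UNIV]]
  have left: "(\<Sum>b\<in>BV. dual b v * \<alpha> (d b w)) = \<alpha> (d v w)"
    using lin(1)[where I = BV and w = "\<lambda>b. b" and c = "\<lambda>b. dual b v"]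
    by (simp add: V.dual_basis_expansion)
  have right: "(\<Sum>c\<in>BV. dual c w * \<alpha> (d b c)) = \<alpha> (d b w)" for b
    using lin(2)[where I = BV and w = "\<lambda>b. b" and c = "\<lambda>c. dual c w"]
    by (simp add: V.dual_basis_expansion)
  have "(\<Sum>b\<in>BV. \<Sum>c\<in>BV. dual b v * dual c w * \<alpha> (d b c)) =
      (\<Sum>b\<in>BV. dual b v * (\<Sum>c\<in>BV. dual c w * \<alpha> (d b c)))"
    by (simp only: sum_distrib_left mult.assoc)
  then show ?thesis by (simp only: right left)
qed

lemma separated_by_forms:
  assumes "\<And>\<alpha>. linear_form_on sA UNIV \<alpha> \<Longrightarrow> \<alpha> x = 0"
  shows "x = 0"
proof (rule ccontr)
  assume "x \<noteq> 0"
  then have "x \<notin> module.span sA {}" by simp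
  then obtain \<alpha> where "linear_form_on sA UNIV \<alpha>" "\<alpha> x = 1"
    using separating_functional[OF A.vector_space_axioms] by metis
  with assms show False by fastforce
qed

text \<open>
  The forms testing one component vanish on the other two, since the \<open>V*\<close> part of an
  element of \<open>A\<close> and the \<open>A\<close> part of a functional are zero.
\<close>

theorem yang_baxter_null_iff:
  "yang_baxter \<in> tensor_null3 scale carrier \<longleftrightarrow>
    O_operator sA succ prec sV lsucc rsucc lprec rprec T"
proof
  assume "yang_baxter \<in> tensor_null3 scale carrier"
  then have null: "trilinear_form_on scale carrier \<phi> \<Longrightarrow> formal_eval \<phi> yang_baxter = 0" for \<phi>
    unfolding tensor_null3_iff_trilinear by blast
  have "defect_succ w v = 0" for v w
  proof (rule separated_by_forms)
    fix \<alpha> assume \<alpha>: "linear_form_on sA UNIV \<alpha>"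
    let ?\<phi> = "\<lambda>(p, q, r). snd p v * \<alpha> (fst q) * snd r w"
    \<comment> \<open>only \<open>V* \<otimes> A \<otimes> V*\<close> contributes; the evaluation points are chosen
      so that the transposed indices of that component give \<open>D\<^sub>\<succ>(w, v)\<close>\<close>
    have tri: "trilinear_form_on scale carrier ?\<phi>"
      using \<alpha> by (simp add: trilinear_form_on_def linear_form_on_def semidirect_scale_def
          dual_scale_def algebra_simps)
    have "\<alpha> (defect_succ w v) = (\<Sum>b\<in>BV. \<Sum>c\<in>BV. dual b w * dual c v * \<alpha> (defect_succ b c))"
      by (rule bilinear_expansion[OF bilinear_defects(1) \<alpha>, symmetric])
    also have "\<dots> = (\<Sum>b\<in>BV. \<Sum>c\<in>BV. dual b v * \<alpha> (defect_succ c b) * dual c w)"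
      by (subst sum.swap) (simp add: mult_ac)
    also have "\<dots> = - formal_eval ?\<phi> yang_baxter"
      by (simp add: formal_eval_yang_baxter[OF tri])
    finally show "\<alpha> (defect_succ w v) = 0" by (simp only: null[OF tri]) simp
  qed
  moreover have "defect_prec v w = 0" for v w
  proof (rule separated_by_forms)
    fix \<alpha> assume \<alpha>: "linear_form_on sA UNIV \<alpha>"
    let ?\<phi> = "\<lambda>(p, q, r). snd p v * snd q w * \<alpha> (fst r)"
    have tri: "trilinear_form_on scale carrier ?\<phi>"
      using \<alpha> by (simp add: trilinear_form_on_def linear_form_on_def semidirect_scale_def
          dual_scale_def algebra_simps)
    have "\<alpha> (defect_prec v w) = (\<Sum>b\<in>BV. \<Sum>c\<in>BV. dual b v * dual c w * \<alpha> (defect_prec b c))"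
      by (rule bilinear_expansion[OF bilinear_defects(2) \<alpha>, symmetric])
    also have "\<dots> = - formal_eval ?\<phi> yang_baxter"
      by (simp add: formal_eval_yang_baxter[OF tri])
    finally show "\<alpha> (defect_prec v w) = 0" by (simp only: null[OF tri]) simp
  qed
  ultimately show "O_operator sA succ prec sV lsucc rsucc lprec rprec T"
    by (simp add: O_operator_iff_defects)
next
  assume "O_operator sA succ prec sV lsucc rsucc lprec rprec T"
  then have "defect_succ u v = 0" "defect_prec u v = 0" for u v
    by (simp_all add: O_operator_iff_defects)
  then show "yang_baxter \<in> tensor_null3 scale carrier"
    unfolding tensor_null3_iff_trilinear
    by (auto simp: formal_eval_yang_baxter slot_linear(1-3) simp flip: zero_prod_def)
qed

lemma keys_skew_tensor: "Poly_Mapping.keys skew_tensor \<subseteq> carrier \<times> carrier"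
proof (rule subsetI, rule ccontr)
  fix x assume x: "x \<in> Poly_Mapping.keys skew_tensor" "x \<notin> carrier \<times> carrier"
  have "Poly_Mapping.lookup skew_tensor x = formal_eval (\<lambda>y. if y = x then 1 else 0) skew_tensor"
    by (rule lookup_eq_formal_eval)
  also have "\<dots> = 0"
  proof -
    have "(if p = x then 1 else 0) = (0 :: 'k)" if "p \<in> carrier \<times> carrier" for p
      using that x(2) by auto
    then show ?thesis by (simp add: formal_eval_skew_tensor)
  qed
  finally show False using x(1) by (simp add: in_keys_iff)
qed

lemma skew_symmetric_skew_tensor: "skew_symmetric_tensor scale carrier skew_tensor"
proof -
  interpret F: vector_space "formal_scale :: 'k \<Rightarrow>
      (('a \<times> ('v \<Rightarrow> 'k)) \<times> ('a \<times> ('v \<Rightarrow> 'k)) \<Rightarrow>\<^sub>0 'k) \<Rightarrow> _"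
    by (rule vector_space_formal_scale)
  show ?thesis
    using keys_skew_tensor F.span_zero
    by (simp add: skew_symmetric_tensor_def tensor_null2_def skew_tensor_def tensor_flip_diff_flip)
qed

end

theorem theorem6p19:
  fixes sA :: "'k::field \<Rightarrow> 'a::ab_group_add \<Rightarrow> 'a" and BA :: "'a set"
    and succ prec :: "'a \<Rightarrow> 'a \<Rightarrow> 'a"
    and sV :: "'k \<Rightarrow> 'v::ab_group_add \<Rightarrow> 'v" and BV :: "'v set"
    and lsucc rsucc lprec rprec :: "'a \<Rightarrow> 'v \<Rightarrow> 'v"
    and T :: "'v \<Rightarrow> 'a"
    and lsucc' rsucc' lprec' rprec' :: "'a \<Rightarrow> ('v \<Rightarrow> 'k) \<Rightarrow> ('v \<Rightarrow> 'k)"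
    and hat_scale :: "'k \<Rightarrow> 'a \<times> ('v \<Rightarrow> 'k) \<Rightarrow> 'a \<times> ('v \<Rightarrow> 'k)"
    and hat_carrier :: "('a \<times> ('v \<Rightarrow> 'k)) set"
    and hat_succ hat_prec ::
      "'a \<times> ('v \<Rightarrow> 'k) \<Rightarrow> 'a \<times> ('v \<Rightarrow> 'k) \<Rightarrow> 'a \<times> ('v \<Rightarrow> 'k)"
    and r :: "('a \<times> ('v \<Rightarrow> 'k)) \<times> ('a \<times> ('v \<Rightarrow> 'k)) \<Rightarrow>\<^sub>0 'k"
  assumes "finite_dimensional_vector_space sA BA"
    and "finite_dimensional_vector_space sV BV"
    and "anti_dendriform_algebra sA UNIV succ prec"
    and "anti_dendriform_representation sA UNIV succ prec sV UNIV lsucc rsucc lprec rprec"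
    and "Vector_Spaces.linear sV sA T"
  defines "lsucc' \<equiv> - (dual_map rprec + dual_map rsucc)"
    and "rsucc' \<equiv> dual_map lprec"
    and "lprec' \<equiv> dual_map rsucc"
    and "rprec' \<equiv> - (dual_map lprec + dual_map lsucc)"
    and "hat_scale \<equiv> semidirect_scale sA dual_scale"
    and "hat_carrier \<equiv> UNIV \<times> dual_space sV"
    and "hat_succ \<equiv> semidirect_prod succ lsucc' rsucc'"
    and "hat_prec \<equiv> semidirect_prod prec lprec' rprec'"
    and "r \<equiv> hom_tensor sV BV T - tensor_flip (hom_tensor sV BV T)"
  shows "skew_symmetric_tensor hat_scale hat_carrier r \<and>
         anti_dendriform_YBE_solution hat_scale hat_carrier hat_succ hat_prec r \<longleftrightarrow>
         O_operator sA succ prec sV lsucc rsucc lprec rprec T"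
proof -
  interpret operator_into_semidirect_product sA sV BV succ prec lsucc rsucc lprec rprec T
    using assms(1-5)
    by (intro operator_into_semidirect_product.intro operator_into_semidirect_product_axioms.intro)
      (auto simp: anti_dendriform_algebra_def anti_dendriform_representation_def)
  show ?thesis
    using yang_baxter_null_iff skew_symmetric_skew_tensor keys_skew_tensor
    unfolding yang_baxter_def skew_tensor_def hsucc_def hprec_def
      anti_dendriform_YBE_solution_def lsucc'_def rsucc'_def lprec'_def rprec'_def
      hat_scale_def hat_carrier_def hat_succ_def hat_prec_def r_def
    by blast
qed

end
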